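(* There exist absolute constants $c_1,c_2>0$ and $x_0\ge 2$ such that for all $x\ge x_0$, $$c_1\frac{x}{(\log x)^{1/2}}\ \le\ F(x):=\sum_{n\le x}\frac{1}{\tau(n^2+1)}\ \le\ c_2\frac{x}{(\log x)^{1/2}},$$ where the sum runs over positive integers $n\le x$ and $\tau(m)=\sum_{d\mid m}1$ is the number of positive divisors of $m$. *)

theory Defs
  imports Complex_Main
begin

text \<open>
  For \<open>m > 0\<close> every divisor of \<open>m\<close> in \<^typ>\<open>nat\<close> is positive, so this is the usual divisor function.
  For \<open>m = 0\<close> the set is infinite and the value is \<open>0\<close>; only arguments \<open>n\<^sup>2 + 1\<close> are used below.
\<close>

definition divisor_tau :: "nat \<Rightarrow> nat" where
  "divisor_tau m = card {d. d dvd m}"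

definition recip_tau_sum :: "real \<Rightarrow> real" where
  "recip_tau_sum x = (\<Sum>n | 1 \<le> n \<and> real n \<le> x. 1 / real (divisor_tau (n\<^sup>2 + 1)))"

end

theory Submission
  imports Defs "HOL-Number_Theory.Number_Theory" "HOL-Analysis.Analysis" "HOL-Real_Asymp.Real_Asymp"
begin

text \<open>
  Fix a small power \<open>y\<close> of \<open>x\<close> and let \<open>P\<close> be the set of primes \<open>p \<le> y\<close> with \<open>p mod 4 = 1\<close>. Since
  \<open>n\<^sup>2 + 1\<close> has boundedly many prime factors above \<open>y\<close>, its number of divisors is, up to a constant and
  up to square factors, \<open>2\<close> to the number of \<open>p \<in> P\<close> dividing it. The reciprocal of this power is the
  probability that a uniformly random subset of \<open>P\<close> contains no divisor of \<open>n\<^sup>2 + 1\<close>, so the sum is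
  an average over subsets \<open>S\<close> of sifted counts. Selberg's \<open>\<Lambda>\<^sup>2\<close> sieve gives each of these counts up to
  constants, uniformly in \<open>S\<close>; for the lower bound a prime outside \<open>S\<close> is replaced by its square, which
  discards the \<open>n\<close> for which \<open>n\<^sup>2 + 1\<close> has a square factor. The average of the sieve densities is
  about \<open>\<Prod>p\<in>P. 1 - 1 / p\<close>, which has order \<open>(ln y) powr (-1/2)\<close> because the partial sums of the
  coefficients of \<open>\<zeta>(s) L(s, \<chi>)\<close> at \<open>s = 1\<close>, \<open>\<chi>\<close> being the character modulo 4, grow like \<open>ln y\<close>.
\<close>

section \<open>Sums over coprime moduli and over subsets\<close>

text \<open>The obstacle is uniformity: the subsets \<open>S\<close> are arbitrary, so the sifting
  density need not be regular, yet the constants must be the same for all of them. The sieve is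
  therefore built to require only upper bounds for the sums of \<open>g q * ln q\<close> and
  \<open>g q * (ln q)\<^sup>2\<close> over its moduli, and these hold for every choice of
  \<open>S\<close>. The price is a constant factor in place of an asymptotic formula. A square is by
  nature an upper bound device. For the lower bound it is multiplied by one minus the number of
  moduli that sift out \<open>n\<close>; the result is positive only at survivors, and the loss is
  controlled because the weights vary slowly. Averaging over \<open>S\<close> brings the density to
  the right size. A prime in \<open>S\<close> has two roots and density factor
  \<open>1 - 2 / p\<close>; the mean of this and 1 is \<open>1 - 1 / p\<close>. With squares as
  substitutes, the mean of \<open>1 - 2 / p\<close> and \<open>1 - 2 / p\<^sup>2\<close> is
  \<open>1 - 1 / p - 1 / p\<^sup>2\<close>, whose product has the same order.\<close>

lemma sum_crt:
  fixes a b :: "nat \<Rightarrow> real"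
  assumes "coprime q M" "q > 0" "M > 0"
    and a: "\<And>n. a (n mod q) = a n" and b: "\<And>n. b (n mod M) = b n"
  shows "(\<Sum>n<q * M. a n * b n) = (\<Sum>n<q. a n) * (\<Sum>n<M. b n)"
proof -
  let ?f = "\<lambda>n. (n mod q, n mod M)"
  have inj: "inj_on ?f {..<q * M}"
  proof (rule inj_onI)
    fix x y assume xy: "x \<in> {..<q * M}" "y \<in> {..<q * M}" "?f x = ?f y"
    then have "[x = y] (mod q)" "[x = y] (mod M)" by (auto simp: unique_euclidean_semiring_class.cong_def)
    then have "[x = y] (mod q * M)" using assms(1) by (rule coprime_cong_mult_nat)
    then show "x = y" using xy by (simp add: unique_euclidean_semiring_class.cong_def)
  qed
  have "?f ` {..<q * M} \<subseteq> {..<q} \<times> {..<M}" using assms by auto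
  then have "?f ` {..<q * M} = {..<q} \<times> {..<M}"
    using inj by (intro card_subset_eq) (auto simp: card_image card_cartesian_product)
  then have "bij_betw ?f {..<q * M} ({..<q} \<times> {..<M})"
    using inj by (simp add: bij_betw_def)
  from sum.reindex_bij_betw[OF this, of "\<lambda>(i, j). a i * b j"]
  have "(\<Sum>n<q * M. a n * b n) = (\<Sum>(i, j)\<in>{..<q} \<times> {..<M}. a i * b j)"
    by (simp add: a b)
  then show ?thesis by (simp add: sum_product sum.cartesian_product)
qed

lemma sum_prod_periodic:
  fixes f :: "nat \<Rightarrow> nat \<Rightarrow> real"
  assumes "finite A" "\<And>q. q \<in> A \<Longrightarrow> q > 0" "pairwise coprime A"
    and per: "\<And>q n. q \<in> A \<Longrightarrow> f q (n mod q) = f q n"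
  shows "(\<Sum>n<\<Prod>A. \<Prod>q\<in>A. f q n) = (\<Prod>q\<in>A. \<Sum>n<q. f q n)"
  using assms
proof (induction A rule: finite_induct)
  case (insert q A)
  have cop: "coprime q (\<Prod>A)"
    using insert by (intro prod_coprime_right) (auto simp: pairwise_insert)
  have b: "(\<Prod>p\<in>A. f p (n mod \<Prod>A)) = (\<Prod>p\<in>A. f p n)" for n
  proof (rule prod.cong)
    fix p assume p: "p \<in> A"
    then have "p dvd \<Prod>A" using dvd_prodI[of A p "\<lambda>x. x"] insert.hyps by simp
    then have "n mod \<Prod>A mod p = n mod p" by (rule mod_mod_cancel)
    then show "f p (n mod \<Prod>A) = f p n"
      using insert.prems(3)[of p n] insert.prems(3)[of p "n mod \<Prod>A"] p by simp
  qed simp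
  have "(\<Sum>n<q * \<Prod>A. f q n * (\<Prod>p\<in>A. f p n)) = (\<Sum>n<q. f q n) * (\<Sum>n<\<Prod>A. \<Prod>p\<in>A. f p n)"
    using insert.prems by (intro sum_crt cop b prod_pos) auto
  then show ?case
    using insert by (simp add: pairwise_insert)
qed simp

text \<open>Full periods contribute the mean exactly. The incomplete period and its share of the
  mean are each at most \<open>M\<close> in absolute value, whence the factor 2.\<close>

lemma sum_periodic_approx:
  fixes f :: "nat \<Rightarrow> real"
  assumes M: "M > 0" and per: "\<And>n. f (n mod M) = f n" and bd: "\<And>n. \<bar>f n\<bar> \<le> 1"
  shows "\<bar>(\<Sum>n<N. f n) - real N * ((\<Sum>n<M. f n) / real M)\<bar> \<le> 2 * real M"
proof -
  let ?T = "\<Sum>n<M. f n"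
  have split: "(\<Sum>n<i + j. f n) = (\<Sum>n<i. f n) + (\<Sum>n<j. f (i + n))" for i j
    by (induction j) simp_all
  have blocks: "(\<Sum>n<M * k + r. f n) = real k * ?T + (\<Sum>n<r. f n)" for k r
  proof (induction k)
    case (Suc k)
    have "(\<Sum>n<M * Suc k + r. f n) = (\<Sum>n<M + (M * k + r). f n)"
      by (simp add: algebra_simps)
    also have "\<dots> = ?T + (\<Sum>n<M * k + r. f (M + n))"
      by (rule split)
    also have "(\<Sum>n<M * k + r. f (M + n)) = (\<Sum>n<M * k + r. f n)"
    proof (rule sum.cong[OF refl])
      show "f (M + n) = f n" for n using per[of "M + n"] per[of n] by simp
    qed
    finally show ?case using Suc by (simp add: algebra_simps)
  qed simp
  define k r where "k = N div M" and "r = N mod M"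
  have N: "N = M * k + r" by (simp add: k_def r_def)
  have r: "r \<le> M" using M by (simp add: r_def less_imp_le)
  have ab: "\<bar>\<Sum>n<j. f n\<bar> \<le> real j" for j
    using order_trans[OF sum_abs[of f "{..<j}"] sum_mono[of "{..<j}" "\<lambda>n. \<bar>f n\<bar>" "\<lambda>_. 1"]] bd by simp
  have "(\<Sum>n<N. f n) - real N * (?T / real M) = (\<Sum>n<r. f n) - real r * (?T / real M)"
    unfolding N blocks using M by (simp add: field_simps)
  moreover have "\<bar>real r * (?T / real M)\<bar> \<le> real r"
  proof -
    have "\<bar>?T / real M\<bar> \<le> 1" using ab[of M] M by simp
    then show ?thesis using mult_left_mono[of "\<bar>?T / real M\<bar>" 1 "real r"] by (simp add: abs_mult)
  qed
  moreover have "\<bar>(\<Sum>n<r. f n) - real r * (?T / real M)\<bar> \<le> \<bar>\<Sum>n<r. f n\<bar> + \<bar>real r * (?T / real M)\<bar>"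
    by (rule abs_triangle_ineq4)
  moreover have "real r \<le> real M" using r by simp
  ultimately show ?thesis using ab[of r] by (simp del: times_divide_eq_right)
qed

text \<open>By the Chinese remainder theorem the residues of a uniform \<open>n\<close> modulo the
  \<open>q \<in> A\<close> are independent, so the mean of the product is the product of the means.
  The error grows with the common period \<open>\<Prod>A\<close>, which is why the sieve must keep
  products of moduli small.\<close>

lemma sum_prod_periodic_approx:
  fixes f :: "nat \<Rightarrow> nat \<Rightarrow> real"
  assumes "finite A" "\<And>q. q \<in> A \<Longrightarrow> q > 0" "pairwise coprime A"
    and per: "\<And>q n. q \<in> A \<Longrightarrow> f q (n mod q) = f q n"
    and bd: "\<And>q n. q \<in> A \<Longrightarrow> \<bar>f q n\<bar> \<le> 1"
  shows "\<bar>(\<Sum>n<N. \<Prod>q\<in>A. f q n) - real N * (\<Prod>q\<in>A. (\<Sum>n<q. f q n) / real q)\<bar> \<le> 2 * real (\<Prod>A)"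
proof -
  have "(\<Prod>p\<in>A. f p (n mod \<Prod>A)) = (\<Prod>p\<in>A. f p n)" for n
  proof (rule prod.cong)
    fix p assume p: "p \<in> A"
    then have "p dvd \<Prod>A" using dvd_prodI[of A p "\<lambda>x. x"] assms by simp
    then have "n mod \<Prod>A mod p = n mod p" by (rule mod_mod_cancel)
    then show "f p (n mod \<Prod>A) = f p n"
      using per[of p n] per[of p "n mod \<Prod>A"] p by simp
  qed simp
  moreover have "\<bar>\<Prod>p\<in>A. f p n\<bar> \<le> 1" for n
    using bd by (simp add: abs_prod prod_le_1)
  moreover have "\<Prod>A > 0" using assms by (intro prod_pos) auto
  ultimately have "\<bar>(\<Sum>n<N. \<Prod>q\<in>A. f q n) - real N * ((\<Sum>n<\<Prod>A. \<Prod>q\<in>A. f q n) / real (\<Prod>A))\<bar> \<le> 2 * real (\<Prod>A)"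
    by (intro sum_periodic_approx)
  then show ?thesis
    using assms by (simp add: sum_prod_periodic prod_dividef)
qed

section \<open>Expansions over subsets and the logarithmic weight\<close>

lemma sum_Pow_insert:
  fixes f :: "'a set \<Rightarrow> 'b::comm_monoid_add"
  assumes "finite A" "x \<notin> A"
  shows "sum f (Pow (insert x A)) = (\<Sum>m\<in>Pow A. f m + f (insert x m))"
proof -
  have "sum f (Pow (insert x A)) = sum f (Pow A) + sum f (insert x ` Pow A)"
    using assms by (subst Pow_insert, intro sum.union_disjoint) auto
  also have "sum f (insert x ` Pow A) = (\<Sum>m\<in>Pow A. f (insert x m))"
    using assms by (subst sum.reindex) (auto simp: inj_on_def)
  finally show ?thesis by (simp add: sum.distrib)
qed

lemma sum_Pow_prod:
  fixes f :: "'a \<Rightarrow> real"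
  assumes "finite A"
  shows "(\<Sum>m\<in>Pow A. \<Prod>q\<in>m. f q) = (\<Prod>q\<in>A. 1 + f q)"
  using prod_add[OF assms, of f "\<lambda>_. 1"] by (simp add: add.commute)

text \<open>Divided by the product of \<open>1 + h q\<close>, this is the expectation of an additive
  function of a random set containing each \<open>q\<close> independently with probability
  \<open>h q / (1 + h q)\<close>.\<close>

lemma sum_Pow_prod_additive:
  fixes h L :: "'a \<Rightarrow> real"
  assumes "finite A" "\<And>q. q \<in> A \<Longrightarrow> h q \<ge> 0"
  shows "(\<Sum>m\<in>Pow A. (\<Prod>q\<in>m. h q) * (\<Sum>q\<in>m. L q)) =
    (\<Prod>q\<in>A. 1 + h q) * (\<Sum>q\<in>A. h q / (1 + h q) * L q)"
  using assms
proof (induction A rule: finite_induct)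
  case (insert x A)
  have *: "(\<Prod>q\<in>insert x m. h q) * (\<Sum>q\<in>insert x m. L q) =
      h x * L x * (\<Prod>q\<in>m. h q) + h x * ((\<Prod>q\<in>m. h q) * (\<Sum>q\<in>m. L q))" if "m \<in> Pow A" for m
  proof -
    have "finite m" "x \<notin> m" using that insert finite_subset by auto
    then show ?thesis by (simp add: algebra_simps)
  qed
  have "(\<Sum>m\<in>Pow (insert x A). (\<Prod>q\<in>m. h q) * (\<Sum>q\<in>m. L q)) =
     (1 + h x) * (\<Sum>m\<in>Pow A. (\<Prod>q\<in>m. h q) * (\<Sum>q\<in>m. L q)) + h x * L x * (\<Sum>m\<in>Pow A. \<Prod>q\<in>m. h q)"
  proof -
    have "(\<Sum>m\<in>Pow (insert x A). (\<Prod>q\<in>m. h q) * (\<Sum>q\<in>m. L q)) =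
      (\<Sum>m\<in>Pow A. (\<Prod>q\<in>m. h q) * (\<Sum>q\<in>m. L q) + (h x * L x * (\<Prod>q\<in>m. h q) + h x * ((\<Prod>q\<in>m. h q) * (\<Sum>q\<in>m. L q))))"
      unfolding sum_Pow_insert[OF insert.hyps] by (intro sum.cong refl arg_cong2[of _ _ _ _ "(+)"] *)
    then show ?thesis
      by (simp only: sum.distrib sum_distrib_left[symmetric]) (simp only: algebra_simps)
  qed
  also have "\<dots> = (1 + h x) * (\<Prod>q\<in>A. 1 + h q) * ((\<Sum>q\<in>A. h q / (1 + h q) * L q) + h x / (1 + h x) * L x)"
  proof -
    have "1 + h x \<noteq> 0" using insert.prems[of x] by auto
    then have "h x * L x = (1 + h x) * (h x / (1 + h x) * L x)" by simp
    moreover have "(\<Sum>m\<in>Pow A. (\<Prod>q\<in>m. h q) * (\<Sum>q\<in>m. L q)) =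
        (\<Prod>q\<in>A. 1 + h q) * (\<Sum>q\<in>A. h q / (1 + h q) * L q)"
      using insert by simp
    ultimately show ?thesis
      using insert.hyps by (simp only: sum_Pow_prod) (simp only: algebra_simps)
  qed
  finally show ?case unfolding prod.insert[OF insert.hyps] sum.insert[OF insert.hyps]
    by (simp only: add.commute)
qed simp

text \<open>For \<open>D > 1\<close> the weight falls linearly in \<open>ln (\<Prod>m)\<close> from
  1 at the empty set to 0 at \<open>\<Prod>m = D\<close>. The continuous decay, in place of a sharp
  cutoff, is what keeps the loss in the lower bound small.\<close>

definition log_weight :: "real \<Rightarrow> nat set \<Rightarrow> real" where
  "log_weight D m = max 0 (1 - ln (real (\<Prod>m)) / ln D)"

text \<open>
  Markov's inequality: if \<open>m\<close> is chosen with probability proportional to \<open>\<Prod>q\<in>m. h q\<close>, then the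
  mean of \<open>ln (\<Prod>m)\<close> is \<open>\<Sum>q\<in>S. h q / (1 + h q) * ln q\<close>. This replaces Rankin's trick below.
\<close>

lemma log_weight_average:
  fixes h :: "nat \<Rightarrow> real"
  assumes "finite S" "\<And>q. q \<in> S \<Longrightarrow> h q \<ge> 0" "\<And>q. q \<in> S \<Longrightarrow> q > 0" "D > 1"
    and small: "2 * (\<Sum>q\<in>S. h q / (1 + h q) * ln (real q)) \<le> ln D"
  shows "(\<Prod>q\<in>S. 1 + h q) / 2 \<le> (\<Sum>m\<in>Pow S. (\<Prod>q\<in>m. h q) * log_weight D m)"
proof -
  let ?H = "\<Prod>q\<in>S. 1 + h q"
  have lnD: "ln D > 0" using assms by simp
  have H0: "?H \<ge> 0" using assms by (intro prod_nonneg) auto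
  have "?H / 2 \<le> ?H * (1 - (\<Sum>q\<in>S. h q / (1 + h q) * ln (real q)) / ln D)"
  proof -
    have "(\<Sum>q\<in>S. h q / (1 + h q) * ln (real q)) / ln D \<le> 1 / 2"
      using small lnD by (simp add: field_simps)
    then show ?thesis using mult_left_mono[OF _ H0, of "1/2"] by auto
  qed
  also have "\<dots> = (\<Sum>m\<in>Pow S. \<Prod>q\<in>m. h q) - (\<Sum>m\<in>Pow S. (\<Prod>q\<in>m. h q) * (\<Sum>q\<in>m. ln (real q))) / ln D"
    using assms by (simp add: sum_Pow_prod sum_Pow_prod_additive algebra_simps)
  also have "\<dots> = (\<Sum>m\<in>Pow S. (\<Prod>q\<in>m. h q) * (1 - (\<Sum>q\<in>m. ln (real q)) / ln D))"
    by (simp only: sum_subtractf right_diff_distrib mult_1_right times_divide_eq_right flip: sum_divide_distrib)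
  also have "\<dots> \<le> (\<Sum>m\<in>Pow S. (\<Prod>q\<in>m. h q) * log_weight D m)"
  proof (intro sum_mono mult_left_mono prod_nonneg ballI)
    fix m assume m: "m \<in> Pow S"
    then have "ln (real (\<Prod>m)) = (\<Sum>q\<in>m. ln (real q))"
      unfolding of_nat_prod using assms(1,3) finite_subset[of m S] by (intro ln_prod) (auto simp: subset_iff)
    then show "1 - (\<Sum>q\<in>m. ln (real q)) / ln D \<le> log_weight D m" by (simp add: log_weight_def)
  qed (use assms in auto)
  finally show ?thesis .
qed

section \<open>A Selberg sieve for coprime moduli\<close>

text \<open>Pairwise coprime moduli behave like primes: a modulus divides \<open>\<Prod>m\<close>
  only if it belongs to \<open>m\<close>, so the product determines the set. Subsets can thus be
  counted and summed as integers.\<close>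

lemma inj_on_Prod_Pow:
  assumes fin: "finite S" and gt1: "\<And>q. q \<in> S \<Longrightarrow> q > 1" and cop: "pairwise coprime S"
  shows "inj_on Prod (Pow (S :: nat set))"
proof -
  have prime_like: "q \<in> m \<longleftrightarrow> q dvd \<Prod>m" if "m \<subseteq> S" "q \<in> S" for q m
  proof
    assume "q \<in> m"
    then show "q dvd \<Prod>m" using dvd_prodI[of m q "\<lambda>x. x"] finite_subset[OF that(1) fin] by simp
  next
    assume d: "q dvd \<Prod>m"
    show "q \<in> m"
    proof (rule ccontr)
      assume "q \<notin> m"
      have "coprime q p" if "p \<in> m" for p
        using pairwiseD[OF cop \<open>q \<in> S\<close>, of p] that \<open>m \<subseteq> S\<close> \<open>q \<notin> m\<close> by blast
      then have "coprime q (\<Prod>m)" by (rule prod_coprime_right)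
      then show False using coprime_common_divisor[of q "\<Prod>m" q] d gt1[OF that(2)] by simp
    qed
  qed
  show ?thesis
  proof (rule inj_onI)
    fix m m' assume m: "m \<in> Pow S" "m' \<in> Pow S" "\<Prod>m = \<Prod>m'"
    then have "q \<in> m \<longleftrightarrow> q \<in> m'" if "q \<in> S" for q
      using prime_like[of m q] prime_like[of m' q] that by simp
    then show "m = m'" using m by auto
  qed
qed

text \<open>\<open>X q n\<close> says that \<open>q\<close> sifts out \<open>n\<close>. The moduli
  are abstract because primes and squares of primes both occur later. Density at most 1/2 gives
  \<open>h q \<le> 1\<close>, hence \<open>\<bar>phi q n\<bar> \<le> 1\<close>.\<close>

locale coprime_sieve =
  fixes S :: "nat set" and X :: "nat \<Rightarrow> nat \<Rightarrow> bool"
  assumes fin: "finite S"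
    and gt1: "q \<in> S \<Longrightarrow> q > 1"
    and cop: "pairwise coprime S"
    and per: "q \<in> S \<Longrightarrow> X q (n mod q) = X q n"
    and half: "q \<in> S \<Longrightarrow> 2 * card {n. n < q \<and> X q n} \<le> q"
begin

text \<open>
  For a random residue, \<open>phi q\<close> has mean \<open>0\<close> and second moment \<open>h q\<close>, and distinct moduli are
  independent. In terms of these variables the quadratic form of Selberg's sieve is already diagonal.
\<close>

definition g :: "nat \<Rightarrow> real" where "g q = card {n. n < q \<and> X q n} / q"
definition h :: "nat \<Rightarrow> real" where "h q = g q / (1 - g q)"
definition phi :: "nat \<Rightarrow> nat \<Rightarrow> real" where "phi q n = (if X q n then - 1 else h q)"

lemma g_bounds: "q \<in> S \<Longrightarrow> 0 \<le> g q" "q \<in> S \<Longrightarrow> g q \<le> 1 / 2"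
  using half[of q] gt1[of q] by (auto simp: g_def field_simps)

lemma h_bounds: "q \<in> S \<Longrightarrow> 0 \<le> h q" "q \<in> S \<Longrightarrow> h q \<le> 1"
  using g_bounds[of q] by (auto simp: h_def field_simps)

lemma one_plus_h: "q \<in> S \<Longrightarrow> 1 + h q = 1 / (1 - g q)"
  using g_bounds[of q] by (auto simp: h_def field_simps)

lemma g_eq_h: "q \<in> S \<Longrightarrow> h q / (1 + h q) = g q"
  using g_bounds[of q] by (auto simp: h_def field_simps)

lemma phi_bound: "q \<in> S \<Longrightarrow> \<bar>phi q n\<bar> \<le> 1"
  using h_bounds[of q] by (auto simp: phi_def)

lemma mean_if:
  assumes "q \<in> S"
  shows "(\<Sum>n<q. if X q n then a else b) / real q = g q * a + (1 - g q) * b"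
proof -
  let ?A = "{n. n < q \<and> X q n}" and ?B = "{n. n < q \<and> \<not> X q n}"
  have "{..<q} = ?A \<union> ?B" by auto
  then have "(\<Sum>n<q. if X q n then a else b) = (\<Sum>n\<in>?A. a) + (\<Sum>n\<in>?B. b)"
    by (simp only:) (subst sum.union_disjoint; auto intro!: arg_cong2[of _ _ _ _ "(+)"] sum.cong)
  moreover have "card ?A + card ?B = q"
    using arg_cong[OF \<open>{..<q} = ?A \<union> ?B\<close>, of card] by (subst card_Un_disjoint[symmetric]) auto
  then have "real (card ?A) + real (card ?B) = real q" by linarith
  then have "real (card ?B) = real q - real (card ?A)" by linarith
  ultimately have "(\<Sum>n<q. if X q n then a else b) = real (card ?A) * a + (real q - real (card ?A)) * b" by simp
  then show ?thesis using gt1[OF assms] by (simp add: g_def field_simps)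
qed

lemma mean_phi: "q \<in> S \<Longrightarrow> (\<Sum>n<q. phi q n) / real q = 0"
  using mean_if[of q "- 1" "h q"] g_bounds[of q] by (simp add: phi_def h_def)

lemma mean_phi_sq: "q \<in> S \<Longrightarrow> (\<Sum>n<q. phi q n * phi q n) / real q = h q"
proof -
  assume q: "q \<in> S"
  have "(\<Sum>n<q. phi q n * phi q n) = (\<Sum>n<q. if X q n then 1 else h q * h q)"
    by (intro sum.cong) (auto simp: phi_def)
  then have "(\<Sum>n<q. phi q n * phi q n) / real q = g q + h q * ((1 - g q) * h q)"
    using mean_if[OF q, of 1 "h q * h q"] by simp
  also have "(1 - g q) * h q = g q" using g_bounds[OF q] by (simp add: h_def)
  also have "g q + h q * g q = h q" using g_bounds[OF q] by (simp add: h_def field_simps)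
  finally show ?thesis .
qed

lemma mean_X: "q \<in> S \<Longrightarrow> (\<Sum>n<q. of_bool (X q n)) / real q = g q"
  using mean_if[of q 1 0] by (simp add: of_bool_def)

text \<open>Distinct sets have distinct products, and these are positive integers up to
  \<open>D\<close>.\<close>

lemma card_small_products:
  assumes "D \<ge> 1"
  shows "real (card {m \<in> Pow S. real (\<Prod>m) \<le> D}) \<le> D"
proof -
  have "inj_on Prod {m \<in> Pow S. real (\<Prod>m) \<le> D}"
    using inj_on_Prod_Pow[OF fin gt1 cop] by (rule inj_on_subset) auto
  moreover have "Prod ` {m \<in> Pow S. real (\<Prod>m) \<le> D} \<subseteq> {1..nat \<lfloor>D\<rfloor>}"
  proof (rule image_subsetI)
    fix m assume m: "m \<in> {m \<in> Pow S. real (\<Prod>m) \<le> D}"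
    then have "\<Prod>m > 0" using gt1 by (intro prod_pos) force
    moreover have "\<Prod>m \<le> nat \<lfloor>D\<rfloor>" using m by (intro le_nat_floor) simp
    ultimately show "\<Prod>m \<in> {1..nat \<lfloor>D\<rfloor>}" by simp
  qed
  ultimately have "card {m \<in> Pow S. real (\<Prod>m) \<le> D} \<le> card {1..nat \<lfloor>D\<rfloor>}"
    by (intro card_inj_on_le) auto
  also have "\<dots> = nat \<lfloor>D\<rfloor>" by simp
  finally have "real (card {m \<in> Pow S. real (\<Prod>m) \<le> D}) \<le> real (nat \<lfloor>D\<rfloor>)" by (rule of_nat_mono)
  also have "\<dots> \<le> D" using assms by (intro of_nat_floor) simp
  finally show ?thesis .
qed

text \<open>Orthogonality: if \<open>m \<noteq> m'\<close>, a modulus in the symmetric difference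
  contributes a single \<open>phi\<close> of mean 0; if \<open>m = m'\<close>, each modulus
  contributes its second moment. \<open>B\<close> holds moduli prescribed to sift out
  \<open>n\<close>: it is empty for the full second moment and a singleton for the loss at one
  modulus.\<close>

lemma pair_approx:
  assumes "m \<subseteq> S" "m' \<subseteq> S" "B \<subseteq> S" "B \<inter> (m \<union> m') = {}"
  shows "\<bar>(\<Sum>n<N. (\<Prod>q\<in>m. phi q n) * (\<Prod>q\<in>m'. phi q n) * (\<Prod>q\<in>B. of_bool (X q n))) -
      real N * (if m = m' then (\<Prod>q\<in>m. h q) * (\<Prod>q\<in>B. g q) else 0)\<bar>
    \<le> 2 * (real (\<Prod>m) * real (\<Prod>m') * real (\<Prod>B))"
proof -
  let ?A = "m \<union> m' \<union> B"
  \<comment> \<open>One factor per modulus, as the periodic product lemma requires: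
    \<open>phi q\<close> occurs squared on \<open>m \<inter> m'\<close>, once on the symmetric
    difference, and \<open>B\<close> carries the indicator.\<close>
  define f where "f q n = (if q \<in> B then of_bool (X q n) else (if q \<in> m then phi q n else 1) * (if q \<in> m' then phi q n else 1))" for q n
  have fin': "finite m" "finite m'" "finite B" using assms fin finite_subset by blast+
  have AS: "?A \<subseteq> S" using assms by blast
  have e: "(\<Prod>q\<in>?A. f q n) = (\<Prod>q\<in>m. phi q n) * (\<Prod>q\<in>m'. phi q n) * (\<Prod>q\<in>B. of_bool (X q n))" for n
  proof -
    have "(\<Prod>q\<in>?A. f q n) = (\<Prod>q\<in>m \<union> m'. f q n) * (\<Prod>q\<in>B. f q n)"
      using fin' assms(4) by (intro prod.union_disjoint) auto
    also have "(\<Prod>q\<in>B. f q n) = (\<Prod>q\<in>B. of_bool (X q n))" by (simp add: f_def)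
    also have "(\<Prod>q\<in>m \<union> m'. f q n) = (\<Prod>q\<in>m \<union> m'. (if q \<in> m then phi q n else 1) * (if q \<in> m' then phi q n else 1))"
      using assms(4) by (intro prod.cong) (auto simp: f_def)
    also have "\<dots> = (\<Prod>q\<in>m. phi q n) * (\<Prod>q\<in>m'. phi q n)"
      using fin' by (simp add: prod.distrib prod.If_cases Int_absorb1)
    finally show ?thesis .
  qed
  have mean: "(\<Prod>q\<in>?A. (\<Sum>n<q. f q n) / real q) = (if m = m' then (\<Prod>q\<in>m. h q) * (\<Prod>q\<in>B. g q) else 0)"
  proof (cases "m = m'")
    case True
    have "(\<Prod>q\<in>?A. (\<Sum>n<q. f q n) / real q) = (\<Prod>q\<in>m. (\<Sum>n<q. f q n) / real q) * (\<Prod>q\<in>B. (\<Sum>n<q. f q n) / real q)"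
      unfolding True Un_absorb using fin' assms(4) by (intro prod.union_disjoint) auto
    also have "(\<Prod>q\<in>m. (\<Sum>n<q. f q n) / real q) = (\<Prod>q\<in>m. h q)"
    proof (rule prod.cong[OF refl])
      fix q assume q: "q \<in> m"
      then have "(\<Sum>n<q. f q n) = (\<Sum>n<q. phi q n * phi q n)"
        using assms(4) True by (intro sum.cong refl) (auto simp: f_def)
      then show "(\<Sum>n<q. f q n) / real q = h q" using mean_phi_sq[of q] q assms(1) by auto
    qed
    also have "(\<Prod>q\<in>B. (\<Sum>n<q. f q n) / real q) = (\<Prod>q\<in>B. g q)"
    proof (rule prod.cong[OF refl])
      fix q assume q: "q \<in> B"
      then have "(\<Sum>n<q. f q n) = (\<Sum>n<q. of_bool (X q n))" by (simp add: f_def)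
      then show "(\<Sum>n<q. f q n) / real q = g q" using mean_X[of q] q assms(3) by auto
    qed
    finally show ?thesis using True by simp
  next
    case False
    then obtain q where q: "q \<in> m \<union> m'" "\<not> (q \<in> m \<and> q \<in> m')" by blast
    then have "(\<Sum>n<q. f q n) / real q = (\<Sum>n<q. phi q n) / real q"
      using assms(4) by (intro arg_cong2[of _ _ _ _ "(/)"] sum.cong refl) (auto simp: f_def)
    also have "\<dots> = 0" using q assms by (intro mean_phi) auto
    finally have "(\<Prod>q\<in>?A. (\<Sum>n<q. f q n) / real q) = 0"
      using q fin' by (intro prod_zero) auto
    then show ?thesis using False by simp
  qed
  have "\<bar>(\<Sum>n<N. \<Prod>q\<in>?A. f q n) - real N * (\<Prod>q\<in>?A. (\<Sum>n<q. f q n) / real q)\<bar> \<le> 2 * real (\<Prod>?A)"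
  proof (rule sum_prod_periodic_approx)
    show "pairwise coprime ?A" using cop AS by (rule pairwise_subset)
    show "q > 0" if "q \<in> ?A" for q using that AS gt1 by force
    show "f q (n mod q) = f q n" if "q \<in> ?A" for q n
      using that AS per[of q n] by (auto simp: f_def phi_def)
    show "\<bar>f q n\<bar> \<le> 1" if "q \<in> ?A" for q n
    proof -
      have "\<bar>phi q n\<bar> * \<bar>phi q n\<bar> \<le> 1" using that AS phi_bound[of q n] by (intro mult_le_one) auto
      then show ?thesis using that AS phi_bound[of q n] by (auto simp: f_def abs_mult)
    qed
  qed (use fin' in auto)
  moreover have "real (\<Prod>?A) \<le> real (\<Prod>m) * real (\<Prod>m') * real (\<Prod>B)"
  proof -
    have "\<Prod>m' > 0" using assms gt1 by (intro prod_pos) force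
    have "\<Prod>(m' - m) \<le> \<Prod>m'"
      using \<open>\<Prod>m' > 0\<close> fin' by (intro dvd_imp_le prod_dvd_prod_subset) auto
    have "\<Prod>?A = \<Prod>(m \<union> (m' - m)) * \<Prod>B"
      using fin' assms(4) by (subst prod.union_disjoint[symmetric]) (auto intro!: prod.cong)
    also have "\<dots> = \<Prod>m * \<Prod>(m' - m) * \<Prod>B"
      using fin' by (subst prod.union_disjoint) auto
    also have "\<dots> \<le> \<Prod>m * \<Prod>m' * \<Prod>B" using \<open>\<Prod>(m' - m) \<le> \<Prod>m'\<close> by simp
    finally show ?thesis by (metis of_nat_le_iff of_nat_mult)
  qed
  ultimately show ?thesis unfolding mean e by linarith
qed

text \<open>Expanding the square, orthogonality leaves the diagonal. At most \<open>D\<close> sets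
  have a nonzero coefficient, so there are at most \<open>D\<^sup>2\<close> pairs, each with error
  at most \<open>2 * D\<^sup>2 * \<Prod>B\<close>.\<close>

lemma square_approx:
  assumes a1: "\<And>m. \<bar>a m\<bar> \<le> 1" and aD: "\<And>m. m \<subseteq> S \<Longrightarrow> a m \<noteq> 0 \<Longrightarrow> real (\<Prod>m) \<le> D"
    and "D \<ge> 1" "B \<subseteq> S"
  shows "\<bar>(\<Sum>n<N. (\<Sum>m\<in>Pow (S - B). a m * (\<Prod>q\<in>m. phi q n))\<^sup>2 * (\<Prod>q\<in>B. of_bool (X q n))) -
      real N * (\<Prod>q\<in>B. g q) * (\<Sum>m\<in>Pow (S - B). (a m)\<^sup>2 * (\<Prod>q\<in>m. h q))\<bar>
    \<le> 2 * D ^ 4 * real (\<Prod>B)"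
proof -
  define Q where "Q = {m \<in> Pow (S - B). a m \<noteq> 0}"
  define W where "W m m' = (\<Sum>n<N. (\<Prod>q\<in>m. phi q n) * (\<Prod>q\<in>m'. phi q n) * (\<Prod>q\<in>B. of_bool (X q n)))" for m m'
  define V where "V m m' = real N * (if m = m' then (\<Prod>q\<in>m. h q) * (\<Prod>q\<in>B. g q) else 0)" for m m'
  have finQ: "finite Q" and finP: "finite (Pow (S - B))" using fin by (auto simp: Q_def)
  have cardQ: "real (card Q) \<le> D"
  proof -
    have "card Q \<le> card {m \<in> Pow S. real (\<Prod>m) \<le> D}"
      using fin aD by (intro card_mono) (auto simp: Q_def)
    then show ?thesis using card_small_products[OF assms(3)] by linarith
  qed
  have e: "(\<Sum>m\<in>Pow (S - B). a m * (\<Prod>q\<in>m. phi q n)) = (\<Sum>m\<in>Q. a m * (\<Prod>q\<in>m. phi q n))" for n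
    using finP by (intro sum.mono_neutral_right) (auto simp: Q_def)
  have "(\<Sum>n<N. (\<Sum>m\<in>Pow (S - B). a m * (\<Prod>q\<in>m. phi q n))\<^sup>2 * (\<Prod>q\<in>B. of_bool (X q n)))
      = (\<Sum>n<N. \<Sum>m\<in>Q. \<Sum>m'\<in>Q. a m * a m' * ((\<Prod>q\<in>m. phi q n) * (\<Prod>q\<in>m'. phi q n) * (\<Prod>q\<in>B. of_bool (X q n))))"
  proof (intro sum.cong[OF refl])
    fix n
    define P where "P m = (\<Prod>q\<in>m. phi q n)" for m
    define Y :: real where "Y = (\<Prod>q\<in>B. of_bool (X q n))"
    have "(\<Sum>m\<in>Q. a m * P m)\<^sup>2 * Y = (\<Sum>m\<in>Q. \<Sum>m'\<in>Q. a m * P m * (a m' * P m')) * Y"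
      by (simp only: power2_eq_square sum_product)
    also have "\<dots> = (\<Sum>m\<in>Q. \<Sum>m'\<in>Q. a m * P m * (a m' * P m') * Y)"
      by (simp only: sum_distrib_right)
    also have "\<dots> = (\<Sum>m\<in>Q. \<Sum>m'\<in>Q. a m * a m' * (P m * P m' * Y))"
      by (intro sum.cong refl) simp
    finally show "(\<Sum>m\<in>Pow (S - B). a m * (\<Prod>q\<in>m. phi q n))\<^sup>2 * (\<Prod>q\<in>B. of_bool (X q n)) =
        (\<Sum>m\<in>Q. \<Sum>m'\<in>Q. a m * a m' * ((\<Prod>q\<in>m. phi q n) * (\<Prod>q\<in>m'. phi q n) * (\<Prod>q\<in>B. of_bool (X q n))))"
      unfolding e P_def Y_def .
  qed
  also have "\<dots> = (\<Sum>m\<in>Q. \<Sum>n<N. \<Sum>m'\<in>Q. a m * a m' * ((\<Prod>q\<in>m. phi q n) * (\<Prod>q\<in>m'. phi q n) * (\<Prod>q\<in>B. of_bool (X q n))))"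
    by (rule sum.swap)
  also have "\<dots> = (\<Sum>m\<in>Q. \<Sum>m'\<in>Q. \<Sum>n<N. a m * a m' * ((\<Prod>q\<in>m. phi q n) * (\<Prod>q\<in>m'. phi q n) * (\<Prod>q\<in>B. of_bool (X q n))))"
    by (intro sum.cong[OF refl] sum.swap)
  also have "\<dots> = (\<Sum>m\<in>Q. \<Sum>m'\<in>Q. a m * a m' * W m m')"
    by (simp only: W_def sum_distrib_left)
  finally have 1: "(\<Sum>n<N. (\<Sum>m\<in>Pow (S - B). a m * (\<Prod>q\<in>m. phi q n))\<^sup>2 * (\<Prod>q\<in>B. of_bool (X q n)))
      = (\<Sum>m\<in>Q. \<Sum>m'\<in>Q. a m * a m' * W m m')" .
  have "real N * (\<Prod>q\<in>B. g q) * (\<Sum>m\<in>Pow (S - B). (a m)\<^sup>2 * (\<Prod>q\<in>m. h q)) =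
      real N * (\<Prod>q\<in>B. g q) * (\<Sum>m\<in>Q. (a m)\<^sup>2 * (\<Prod>q\<in>m. h q))"
    using finP by (intro arg_cong2[of _ _ _ _ "(*)"] refl sum.mono_neutral_right) (auto simp: Q_def)
  also have "\<dots> = (\<Sum>m\<in>Q. \<Sum>m'\<in>Q. a m * a m' * V m m')"
    unfolding sum_distrib_left
  proof (rule sum.cong[OF refl])
    fix m assume "m \<in> Q"
    have "(\<Sum>m'\<in>Q. a m * a m' * V m m') = (\<Sum>m'\<in>Q. if m = m' then a m * a m' * V m m' else 0)"
      by (intro sum.cong) (auto simp: V_def)
    also have "\<dots> = a m * a m * V m m" using finQ \<open>m \<in> Q\<close> by simp
    finally show "real N * (\<Prod>q\<in>B. g q) * ((a m)\<^sup>2 * (\<Prod>q\<in>m. h q)) = (\<Sum>m'\<in>Q. a m * a m' * V m m')"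
      by (simp add: V_def power2_eq_square)
  qed
  finally have 2: "real N * (\<Prod>q\<in>B. g q) * (\<Sum>m\<in>Pow (S - B). (a m)\<^sup>2 * (\<Prod>q\<in>m. h q)) =
      (\<Sum>m\<in>Q. \<Sum>m'\<in>Q. a m * a m' * V m m')" .
  define b where "b = real (\<Prod>B)"
  have B0: "b \<ge> 0" by (simp add: b_def del: of_nat_prod)
  have term_bound: "\<bar>a m * a m' * (W m m' - V m m')\<bar> \<le> 2 * (D * D * b)" if "m \<in> Q" "m' \<in> Q" for m m'
  proof -
    have sub: "m \<subseteq> S" "m' \<subseteq> S" "B \<inter> (m \<union> m') = {}" using that by (auto simp: Q_def)
    have "real (\<Prod>m) \<le> D" "real (\<Prod>m') \<le> D" using that sub aD by (auto simp: Q_def)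
    then have "real (\<Prod>m) * real (\<Prod>m') * b \<le> D * D * b"
      using B0 assms(3) by (intro mult_mono) (auto simp del: of_nat_prod)
    then have "\<bar>W m m' - V m m'\<bar> \<le> 2 * (D * D * b)"
      using pair_approx[OF sub(1,2) assms(4) sub(3), of N] unfolding W_def V_def b_def by linarith
    moreover have "\<bar>a m * a m'\<bar> \<le> 1" using a1 by (simp add: abs_mult mult_le_one)
    ultimately have "\<bar>a m * a m'\<bar> * \<bar>W m m' - V m m'\<bar> \<le> 1 * (2 * (D * D * b))"
      by (intro mult_mono) auto
    then show ?thesis by (simp add: abs_mult)
  qed
  have "\<bar>(\<Sum>m\<in>Q. \<Sum>m'\<in>Q. a m * a m' * W m m') - (\<Sum>m\<in>Q. \<Sum>m'\<in>Q. a m * a m' * V m m')\<bar>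
      = \<bar>\<Sum>m\<in>Q. \<Sum>m'\<in>Q. a m * a m' * (W m m' - V m m')\<bar>"
    by (simp only: sum_subtractf right_diff_distrib)
  also have "\<dots> \<le> (\<Sum>m\<in>Q. \<bar>\<Sum>m'\<in>Q. a m * a m' * (W m m' - V m m')\<bar>)"
    by (rule sum_abs)
  also have "\<dots> \<le> (\<Sum>m\<in>Q. \<Sum>m'\<in>Q. \<bar>a m * a m' * (W m m' - V m m')\<bar>)"
    by (rule sum_mono) (rule sum_abs)
  also have "\<dots> \<le> (\<Sum>m\<in>Q. \<Sum>m'\<in>Q. 2 * (D * D * b))"
    by (intro sum_mono term_bound)
  also have "\<dots> = real (card Q) * real (card Q) * (2 * (D * D * b))" by simp
  also have "\<dots> \<le> D * D * (2 * (D * D * b))"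
    using cardQ B0 assms(3) by (intro mult_right_mono mult_mono) auto
  also have "\<dots> = 2 * D ^ 4 * b" by (simp add: power4_eq_xxxx)
  finally show ?thesis unfolding 1 2 b_def .
qed

end

lemma log_weight_bounds:
  assumes "D > 1"
  shows "0 \<le> log_weight D m" "log_weight D m \<le> 1"
proof -
  \<comment> \<open>The convention \<open>ln 0 = 0\<close> covers a vanishing product.\<close>
  have "ln (real (\<Prod>m)) \<ge> 0" by (cases "\<Prod>m = 0") (auto simp del: of_nat_prod)
  then show "log_weight D m \<le> 1" using assms by (simp add: log_weight_def del: of_nat_prod)
qed (simp add: log_weight_def)

lemma log_weight_nonzero:
  assumes "D > 1" "log_weight D m \<noteq> 0"
  shows "real (\<Prod>m) \<le> D"
proof (cases "\<Prod>m = 0")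
  case False
  then have "ln (real (\<Prod>m)) < ln D"
    using assms by (auto simp: log_weight_def max_def field_simps simp del: of_nat_prod split: if_splits)
  then show ?thesis using assms False by (simp del: of_nat_prod)
qed (use assms in simp)

text \<open>Truncation at 0 is 1-Lipschitz, so adding \<open>q\<close> moves the weight by at most
  what it adds to \<open>ln (\<Prod>m) / ln D\<close>.\<close>

lemma log_weight_insert:
  assumes "D > 1" "finite m" "q \<notin> m" "q > 0" "\<Prod>m > 0"
  shows "\<bar>log_weight D m - log_weight D (insert q m)\<bar> \<le> ln (real q) / ln D"
proof -
  have "ln (real (\<Prod>(insert q m))) = ln (real q) + ln (real (\<Prod>m))"
    using assms(2-5) by (simp add: ln_mult del: of_nat_prod prod_pos_nat_iff prod_zero_iff)
  moreover have "ln (real q) / ln D \<ge> 0" using assms by simp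
  ultimately show ?thesis
    by (simp add: log_weight_def add_divide_distrib del: of_nat_prod)
qed

section \<open>Upper and lower bounds for the sifted count\<close>

context coprime_sieve
begin

definition sifted :: "nat \<Rightarrow> nat" where
  "sifted N = card {n. n < N \<and> (\<forall>q\<in>S. \<not> X q n)}"

text \<open>Selberg's linear form in diagonal coordinates: as
  \<open>phi q n = h q - (1 + h q) * of_bool (X q n)\<close>, expanding the products gives a
  combination of indicators that all moduli of a subset sift out \<open>n\<close>.\<close>

definition lambda_sum :: "real \<Rightarrow> nat \<Rightarrow> real" where
  "lambda_sum D n = (\<Sum>m\<in>Pow S. log_weight D m * (\<Prod>q\<in>m. phi q n))"

definition main_weight :: "real \<Rightarrow> real" where
  "main_weight D = (\<Sum>m\<in>Pow S. (\<Prod>q\<in>m. h q) * log_weight D m)"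

abbreviation "H \<equiv> \<Prod>q\<in>S. 1 + h q"

lemma H_eq: "1 / H = (\<Prod>q\<in>S. 1 - g q)"
  by (simp add: one_plus_h prod_dividef cong: prod.cong)

lemma H_ge1: "H \<ge> 1"
  using h_bounds by (intro prod_ge_1) auto

lemma h_prod_nonneg: "m \<subseteq> S \<Longrightarrow> 0 \<le> (\<Prod>q\<in>m. h q)"
  using h_bounds by (intro prod_nonneg) auto

lemma sifted_eq: "real (sifted N) = (\<Sum>n<N. of_bool (\<forall>q\<in>S. \<not> X q n))"
proof -
  have "{n. n < N \<and> (\<forall>q\<in>S. \<not> X q n)} = {..<N} \<inter> {n. \<forall>q\<in>S. \<not> X q n}" by auto
  then show ?thesis by (simp add: sifted_def of_bool_def sum.If_cases)
qed

lemma lambda_sum_unsifted: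
  assumes "\<forall>q\<in>S. \<not> X q n"
  shows "lambda_sum D n = main_weight D"
proof -
  have "(\<Prod>q\<in>m. phi q n) = (\<Prod>q\<in>m. h q)" if "m \<in> Pow S" for m
    using that assms by (intro prod.cong) (auto simp: phi_def)
  then show ?thesis unfolding lambda_sum_def main_weight_def by (intro sum.cong) auto
qed

lemma main_weight_bounds:
  assumes "D > 1" "2 * (\<Sum>q\<in>S. g q * ln (real q)) \<le> ln D"
  shows "H / 2 \<le> main_weight D" "main_weight D \<le> H"
proof -
  have "(\<Sum>q\<in>S. h q / (1 + h q) * ln (real q)) = (\<Sum>q\<in>S. g q * ln (real q))"
    by (intro sum.cong refl) (simp only: g_eq_h)
  then show "H / 2 \<le> main_weight D"
    unfolding main_weight_def using fin h_bounds gt1 assms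
    by (intro log_weight_average) (auto intro: order.strict_trans[OF zero_less_one])
  have "main_weight D \<le> (\<Sum>m\<in>Pow S. (\<Prod>q\<in>m. h q) * 1)" unfolding main_weight_def
    using h_prod_nonneg log_weight_bounds[OF assms(1)] by (intro sum_mono mult_left_mono) auto
  then show "main_weight D \<le> H" using sum_Pow_prod[OF fin] by simp
qed

lemma lambda_square_approx:
  assumes "D > 1"
  shows "\<bar>(\<Sum>n<N. (lambda_sum D n)\<^sup>2) - real N * (\<Sum>m\<in>Pow S. (log_weight D m)\<^sup>2 * (\<Prod>q\<in>m. h q))\<bar>
    \<le> 2 * D ^ 4"
  using square_approx[of "log_weight D" D "{}" N] assms log_weight_bounds[OF assms]
    log_weight_nonzero[OF assms] by (simp add: lambda_sum_def)

text \<open>At survivors the linear form equals \<open>main_weight D\<close>, which is at least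
  \<open>H / 2\<close>, while its second moment is at most \<open>N * H\<close> up to the error. The
  quotient is \<open>4 * N / H\<close>, and \<open>1 / H\<close> is the product of the
  \<open>1 - g q\<close>.\<close>

lemma sifted_upper:
  assumes "D > 1" "2 * (\<Sum>q\<in>S. g q * ln (real q)) \<le> ln D"
  shows "real (sifted N) \<le> 4 * real N * (\<Prod>q\<in>S. 1 - g q) + 8 * D ^ 4"
proof -
  let ?G = "main_weight D"
  note G = main_weight_bounds[OF assms]
  have "real (sifted N) * ?G\<^sup>2 = (\<Sum>n<N. of_bool (\<forall>q\<in>S. \<not> X q n) * ?G\<^sup>2)"
    by (simp add: sifted_eq sum_distrib_right)
  also have "\<dots> \<le> (\<Sum>n<N. (lambda_sum D n)\<^sup>2)"
    by (intro sum_mono) (auto simp: lambda_sum_unsifted)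
  also have "\<dots> \<le> real N * (\<Sum>m\<in>Pow S. (log_weight D m)\<^sup>2 * (\<Prod>q\<in>m. h q)) + 2 * D ^ 4"
    using lambda_square_approx[OF assms(1), of N] by linarith
  also have "(\<Sum>m\<in>Pow S. (log_weight D m)\<^sup>2 * (\<Prod>q\<in>m. h q)) \<le> (\<Sum>m\<in>Pow S. 1 * (\<Prod>q\<in>m. h q))"
    using log_weight_bounds[OF assms(1)] h_prod_nonneg
    by (intro sum_mono mult_right_mono) (auto simp: power_le_one)
  also have "\<dots> = H" using sum_Pow_prod[OF fin] by simp
  finally have main: "real (sifted N) * ?G\<^sup>2 \<le> real N * H + 2 * D ^ 4"
    by (simp add: mult_left_mono)
  have "real (sifted N) * (H / 2)\<^sup>2 \<le> real (sifted N) * ?G\<^sup>2"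
    using G H_ge1 by (intro mult_left_mono power_mono) auto
  then have "real (sifted N) * H\<^sup>2 \<le> 4 * real N * H + 8 * D ^ 4"
    using main by (simp add: power_divide)
  then have "real (sifted N) \<le> (4 * real N * H + 8 * D ^ 4) / H\<^sup>2"
    using H_ge1 by (subst pos_le_divide_eq) auto
  also have "\<dots> = 4 * real N * (1 / H) + 8 * D ^ 4 / H\<^sup>2"
    using H_ge1 by (simp add: field_simps power2_eq_square)
  also have "8 * D ^ 4 / H\<^sup>2 \<le> 8 * D ^ 4 / 1"
    using H_ge1 assms by (intro divide_left_mono) auto
  finally show ?thesis by (simp add: H_eq)
qed

text \<open>
  If \<open>q\<close> sifts out \<open>n\<close>, then \<open>phi q n = - 1\<close> pairs \<open>m\<close> with \<open>insert q m\<close> in \<open>lambda_sum\<close>; as \<open>log_weight\<close>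
  varies slowly, what remains is small by a factor \<open>ln q / ln D\<close>.
\<close>

lemma lambda_square_moduli:
  assumes "D > 1" "q \<in> S"
  shows "(\<Sum>n<N. (lambda_sum D n)\<^sup>2 * of_bool (X q n)) \<le>
    real N * H * (g q * (ln (real q))\<^sup>2 / (ln D)\<^sup>2) + 2 * D ^ 4 * real q"
proof -
  define a where "a m = log_weight D m - log_weight D (insert q m)" for m
  let ?R = "S - {q}"
  have pos: "\<Prod>m > 0" "finite m" if "m \<subseteq> S" for m
  proof -
    show "finite m" using that fin finite_subset by blast
    show "\<Prod>m > 0"
    proof (rule prod_pos)
      fix p assume "p \<in> m"
      then show "p > 0" using that gt1[of p] by auto
    qed
  qed
  have R: "finite ?R" "q \<notin> ?R" using fin by auto
  have collapse: "(lambda_sum D n)\<^sup>2 * of_bool (X q n) =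
      (\<Sum>m\<in>Pow ?R. a m * (\<Prod>p\<in>m. phi p n))\<^sup>2 * of_bool (X q n)" for n
  proof (cases "X q n")
    case True
    have "lambda_sum D n = (\<Sum>m\<in>Pow (insert q ?R). log_weight D m * (\<Prod>p\<in>m. phi p n))"
      using assms(2) by (simp add: lambda_sum_def insert_absorb)
    also have "\<dots> = (\<Sum>m\<in>Pow ?R. a m * (\<Prod>p\<in>m. phi p n))"
      unfolding sum_Pow_insert[OF R]
    proof (rule sum.cong[OF refl])
      fix m assume m: "m \<in> Pow ?R"
      then have "(\<Prod>p\<in>insert q m. phi p n) = - (\<Prod>p\<in>m. phi p n)"
        using True pos[of m] by (subst prod.insert) (auto simp: phi_def)
      then show "log_weight D m * (\<Prod>p\<in>m. phi p n) + log_weight D (insert q m) * (\<Prod>p\<in>insert q m. phi p n)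
          = a m * (\<Prod>p\<in>m. phi p n)"
        by (simp add: a_def algebra_simps)
    qed
    finally show ?thesis by simp
  qed simp
  have a1: "\<bar>a m\<bar> \<le> 1" for m
    using log_weight_bounds[OF assms(1), of m] log_weight_bounds[OF assms(1), of "insert q m"]
    unfolding a_def by linarith
  have aD: "real (\<Prod>m) \<le> D" if "m \<subseteq> S" and nz: "a m \<noteq> 0" for m
  proof -
    have "q \<notin> m" using nz by (auto simp: a_def insert_absorb)
    consider "log_weight D m \<noteq> 0" | "log_weight D (insert q m) \<noteq> 0"
      using nz unfolding a_def by fastforce
    then show ?thesis
    proof cases
      case 2
      have "\<Prod>m \<le> q * \<Prod>m" using gt1[OF assms(2)] by simp
      also have "\<dots> = \<Prod>(insert q m)" using \<open>q \<notin> m\<close> pos[OF \<open>m \<subseteq> S\<close>] by simp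
      finally have "real (\<Prod>m) \<le> real (\<Prod>(insert q m))" by (rule of_nat_mono)
      then show ?thesis using log_weight_nonzero[OF assms(1) 2] by linarith
    qed (rule log_weight_nonzero[OF assms(1)])
  qed
  have bnd: "(a m)\<^sup>2 \<le> (ln (real q) / ln D)\<^sup>2" if "m \<in> Pow ?R" for m
  proof -
    have "m \<subseteq> S" "q \<notin> m" using that by auto
    then have "\<bar>a m\<bar> \<le> ln (real q) / ln D"
      using assms pos gt1[OF assms(2)] unfolding a_def by (intro log_weight_insert) auto
    then show ?thesis using power_mono[of "\<bar>a m\<bar>" _ 2] by simp
  qed
  have "(\<Sum>m\<in>Pow ?R. (a m)\<^sup>2 * (\<Prod>p\<in>m. h p)) \<le> (\<Sum>m\<in>Pow ?R. (ln (real q) / ln D)\<^sup>2 * (\<Prod>p\<in>m. h p))"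
    using h_prod_nonneg bnd by (intro sum_mono mult_right_mono) auto
  also have "\<dots> \<le> (\<Sum>m\<in>Pow S. (ln (real q) / ln D)\<^sup>2 * (\<Prod>p\<in>m. h p))"
    using fin h_prod_nonneg by (intro sum_mono2) auto
  also have "\<dots> = (ln (real q) / ln D)\<^sup>2 * H"
    using sum_Pow_prod[OF fin] by (simp add: sum_distrib_left[symmetric])
  finally have S1: "(\<Sum>m\<in>Pow ?R. (a m)\<^sup>2 * (\<Prod>p\<in>m. h p)) \<le> (ln (real q) / ln D)\<^sup>2 * H" .
  have "\<bar>(\<Sum>n<N. (\<Sum>m\<in>Pow ?R. a m * (\<Prod>p\<in>m. phi p n))\<^sup>2 * of_bool (X q n)) -
      real N * g q * (\<Sum>m\<in>Pow ?R. (a m)\<^sup>2 * (\<Prod>p\<in>m. h p))\<bar> \<le> 2 * D ^ 4 * real q"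
    using square_approx[of a D "{q}" N, OF a1 aD] assms by simp
  then have "(\<Sum>n<N. (lambda_sum D n)\<^sup>2 * of_bool (X q n)) \<le>
      real N * g q * (\<Sum>m\<in>Pow ?R. (a m)\<^sup>2 * (\<Prod>p\<in>m. h p)) + 2 * D ^ 4 * real q"
    unfolding collapse by linarith
  also have "real N * g q * (\<Sum>m\<in>Pow ?R. (a m)\<^sup>2 * (\<Prod>p\<in>m. h p)) \<le> real N * g q * ((ln (real q) / ln D)\<^sup>2 * H)"
    using S1 g_bounds[OF assms(2)] by (intro mult_left_mono) auto
  finally show ?thesis by (simp add: power_divide mult_ac)
qed

text \<open>The squared linear form times one minus the number of moduli sifting out
  \<open>n\<close> is at most \<open>H\<^sup>2\<close> at survivors and at most 0 elsewhere. Its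
  main term is at least \<open>N * H / 4\<close>; the hypothesis \<open>sq\<close> bounds the loss
  by \<open>N * H / 8\<close>, so half of that remains.\<close>

lemma sifted_lower:
  assumes "D > 1" "2 * (\<Sum>q\<in>S. g q * ln (real q)) \<le> ln D"
    and sq: "8 * (\<Sum>q\<in>S. g q * (ln (real q))\<^sup>2) \<le> (ln D)\<^sup>2"
    and le: "\<And>q. q \<in> S \<Longrightarrow> real q \<le> D"
  shows "real N / 8 * (\<Prod>q\<in>S. 1 - g q) - 4 * D ^ 6 \<le> real (sifted N)"
proof -
  let ?G = "main_weight D"
  note G = main_weight_bounds[OF assms(1,2)]
  have lnD: "ln D > 0" using assms by simp
  let ?C = "\<Sum>m\<in>Pow S. (log_weight D m)\<^sup>2 * (\<Prod>q\<in>m. h q)"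
  \<comment> \<open>Since \<open>w\<^sup>2 \<ge> w - 1 / 4\<close> for every real \<open>w\<close>,
    the sum of squared weights is at least \<open>main_weight D - H / 4\<close>.\<close>
  have "H / 4 \<le> ?G - H / 4" using G by simp
  also have "\<dots> = (\<Sum>m\<in>Pow S. (log_weight D m - 1 / 4) * (\<Prod>q\<in>m. h q))"
  proof -
    have "?G = (\<Sum>m\<in>Pow S. log_weight D m * (\<Prod>q\<in>m. h q))"
      unfolding main_weight_def by (simp only: mult.commute)
    moreover have "H / 4 = (\<Sum>m\<in>Pow S. 1 / 4 * (\<Prod>q\<in>m. h q))"
      unfolding sum_distrib_left[symmetric] sum_Pow_prod[OF fin] by simp
    ultimately show ?thesis by (simp only: left_diff_distrib sum_subtractf)
  qed
  also have "\<dots> \<le> ?C"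
  proof (intro sum_mono mult_right_mono)
    fix m
    show "log_weight D m - 1 / 4 \<le> (log_weight D m)\<^sup>2"
      using zero_le_power2[of "log_weight D m - 1 / 2"] by (simp add: power2_diff power_divide)
  qed (use h_prod_nonneg in auto)
  finally have C: "H / 4 \<le> ?C" .
  \<comment> \<open>The moduli are distinct integers up to \<open>D\<close>, so
    \<open>card S\<close> errors of size \<open>2 * D ^ 5\<close> add up to at most
    \<open>2 * D ^ 6\<close>.\<close>
  have cardS: "real (card S) \<le> D"
  proof -
    have "S \<subseteq> {1..nat \<lfloor>D\<rfloor>}" using gt1 le by (force intro: le_nat_floor)
    then have "card S \<le> nat \<lfloor>D\<rfloor>" using card_mono[of "{1..nat \<lfloor>D\<rfloor>}" S] by simp
    moreover have "real (nat \<lfloor>D\<rfloor>) \<le> D" using assms by (intro of_nat_floor) simp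
    ultimately show ?thesis by linarith
  qed
  have "(\<Sum>n<N. (lambda_sum D n)\<^sup>2) - (\<Sum>q\<in>S. \<Sum>n<N. (lambda_sum D n)\<^sup>2 * of_bool (X q n))
      = (\<Sum>n<N. (lambda_sum D n)\<^sup>2 * (1 - (\<Sum>q\<in>S. of_bool (X q n))))"
    by (subst sum.swap) (simp add: right_diff_distrib sum_subtractf sum_distrib_left)
  also have "\<dots> \<le> (\<Sum>n<N. of_bool (\<forall>q\<in>S. \<not> X q n) * ?G\<^sup>2)"
  proof (rule sum_mono)
    fix n
    show "(lambda_sum D n)\<^sup>2 * (1 - (\<Sum>q\<in>S. of_bool (X q n))) \<le> of_bool (\<forall>q\<in>S. \<not> X q n) * ?G\<^sup>2"
    proof (cases "\<forall>q\<in>S. \<not> X q n")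
      case True
      then show ?thesis by (simp add: lambda_sum_unsifted)
    next
      case False
      then obtain q where "q \<in> S" "X q n" by blast
      then have "(1::real) \<le> (\<Sum>q\<in>S. of_bool (X q n))"
        using member_le_sum[of q S "\<lambda>q. of_bool (X q n) :: real"] fin by simp
      then show ?thesis using False by (auto simp: mult_nonneg_nonpos)
    qed
  qed
  also have "\<dots> = real (sifted N) * ?G\<^sup>2"
    by (simp add: sifted_eq sum_distrib_right)
  also have "\<dots> \<le> real (sifted N) * H\<^sup>2"
    using G H_ge1 by (intro mult_left_mono power_mono) auto
  finally have low: "(\<Sum>n<N. (lambda_sum D n)\<^sup>2) - (\<Sum>q\<in>S. \<Sum>n<N. (lambda_sum D n)\<^sup>2 * of_bool (X q n))
      \<le> real (sifted N) * H\<^sup>2" .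
  have "(\<Sum>q\<in>S. \<Sum>n<N. (lambda_sum D n)\<^sup>2 * of_bool (X q n)) \<le>
      (\<Sum>q\<in>S. real N * H * (g q * (ln (real q))\<^sup>2 / (ln D)\<^sup>2) + 2 * D ^ 4 * D)"
  proof (rule sum_mono)
    fix q assume q: "q \<in> S"
    have "2 * D ^ 4 * real q \<le> 2 * D ^ 4 * D" using le[OF q] assms(1) by (intro mult_left_mono) auto
    then show "(\<Sum>n<N. (lambda_sum D n)\<^sup>2 * of_bool (X q n)) \<le>
        real N * H * (g q * (ln (real q))\<^sup>2 / (ln D)\<^sup>2) + 2 * D ^ 4 * D"
      using lambda_square_moduli[OF assms(1) q, of N] by linarith
  qed
  also have "\<dots> = real N * H * ((\<Sum>q\<in>S. g q * (ln (real q))\<^sup>2) / (ln D)\<^sup>2) + real (card S) * (2 * D ^ 4 * D)"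
    by (simp add: sum.distrib sum_distrib_left sum_divide_distrib)
  also have "\<dots> \<le> real N * H * (1 / 8) + D * (2 * D ^ 4 * D)"
    using sq lnD H_ge1 cardS assms(1)
    by (intro add_mono mult_left_mono mult_right_mono) (auto simp: field_simps)
  also have "D * (2 * D ^ 4 * D) = 2 * D ^ 6" by (simp add: eval_nat_numeral)
  finally have T2: "(\<Sum>q\<in>S. \<Sum>n<N. (lambda_sum D n)\<^sup>2 * of_bool (X q n)) \<le> real N * H * (1 / 8) + 2 * D ^ 6" .
  have "real N * (H / 4) \<le> real N * ?C" using C by (intro mult_left_mono) auto
  then have T1: "real N * (H / 4) - 2 * D ^ 4 \<le> (\<Sum>n<N. (lambda_sum D n)\<^sup>2)"
    using lambda_square_approx[OF assms(1), of N] by linarith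
  have "D ^ 4 \<le> D ^ 6" using assms(1) by (intro power_increasing) auto
  then have "real N * H / 8 - 4 * D ^ 6 \<le> real (sifted N) * H\<^sup>2"
    using low T1 T2 by (simp add: field_simps)
  then have "(real N * H / 8 - 4 * D ^ 6) / H\<^sup>2 \<le> real (sifted N)"
    using H_ge1 by (subst pos_divide_le_eq) auto
  moreover have "(real N * H / 8 - 4 * D ^ 6) / H\<^sup>2 = real N / 8 * (1 / H) - 4 * D ^ 6 / H\<^sup>2"
    using H_ge1 by (simp add: field_simps power2_eq_square)
  moreover have "4 * D ^ 6 / H\<^sup>2 \<le> 4 * D ^ 6 / 1"
    using H_ge1 assms(1) by (intro divide_left_mono) auto
  ultimately show ?thesis by (simp add: H_eq)
qed

end

section \<open>Primes congruent to 1 modulo 4\<close>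

lemma prod_dvd_coprime:
  fixes f :: "'a \<Rightarrow> nat"
  assumes "finite Q" "\<And>p. p \<in> Q \<Longrightarrow> f p dvd n"
    and "\<And>p q. p \<in> Q \<Longrightarrow> q \<in> Q \<Longrightarrow> p \<noteq> q \<Longrightarrow> coprime (f p) (f q)"
  shows "(\<Prod>p\<in>Q. f p) dvd n"
  using assms
proof (induction Q rule: finite_induct)
  case (insert p Q)
  have "coprime (f p) (\<Prod>p\<in>Q. f p)"
    using insert.hyps insert.prems(2) by (intro prod_coprime_right) auto
  then show ?case using insert by (simp add: divides_mult)
qed simp

text \<open>Each of the factors \<open>p\<close>, \<open>2 * p\<close>, up to \<open>k * p\<close>
  of the factorial supplies one \<open>p\<close>; the induction splits off the last.\<close>

lemma power_dvd_fact_mult: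
  assumes "p > 0"
  shows "p ^ k dvd (fact (k * p) :: nat)"
proof (induction k)
  case (Suc k)
  have *: "fact (Suc k * p) = Suc k * p * fact (Suc k * p - 1)"
    using assms by (subst fact_reduce) simp_all
  have "fact (k * p) dvd (fact (Suc k * p - 1) :: nat)"
    using assms by (intro fact_dvd) simp
  then have "p ^ k dvd fact (Suc k * p - 1)" using Suc dvd_trans by blast
  then show ?case unfolding * by (simp add: mult_dvd_mono mult.assoc)
qed simp

text \<open>The product of the powers \<open>p ^ (n div p)\<close> divides \<open>fact n\<close>,
  which is at most \<open>n ^ n\<close>. Taking logarithms gives the bound, the factor 2 coming from
  \<open>n div p \<ge> n / (2 * p)\<close> for \<open>p \<le> n\<close>.\<close>

lemma sum_ln_over_primes_le:
  assumes "n \<ge> 1"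
  shows "(\<Sum>p | prime p \<and> p \<le> n. ln (real p) / real p) \<le> 2 * ln (real n)"
proof -
  let ?P = "{p::nat. prime p \<and> p \<le> n}"
  have fin: "finite ?P" by simp
  have "(\<Prod>p\<in>?P. p ^ (n div p)) dvd fact n"
  proof (rule prod_dvd_coprime[OF fin])
    fix p assume p: "p \<in> ?P"
    have "fact (n div p * p) dvd (fact n :: nat)" by (intro fact_dvd) simp
    moreover have "p > 0" using p by (auto simp: prime_gt_0_nat)
    ultimately show "p ^ (n div p) dvd fact n" using power_dvd_fact_mult[of p "n div p"] dvd_trans by blast
  next
    fix p q assume "p \<in> ?P" "q \<in> ?P" "p \<noteq> q"
    then have "coprime p q" by (intro primes_coprime) auto
    then show "coprime (p ^ (n div p)) (q ^ (n div q))" by simp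
  qed
  then have "(\<Prod>p\<in>?P. p ^ (n div p)) \<le> fact n" by (intro dvd_imp_le) auto
  also have "(fact n :: nat) \<le> n ^ n" using fact_le_power[of n, where 'a = nat] by simp
  finally have "real (\<Prod>p\<in>?P. p ^ (n div p)) \<le> real (n ^ n)" by (rule of_nat_mono)
  moreover have "(\<Prod>p\<in>?P. real p ^ (n div p)) > 0" by (intro prod_pos) (auto simp: prime_gt_0_nat)
  ultimately have "ln (\<Prod>p\<in>?P. real p ^ (n div p)) \<le> ln (real n ^ n)"
    using assms by (subst ln_le_cancel_iff) auto
  also have "\<dots> = real n * ln (real n)" using assms by (simp add: ln_realpow)
  also have "ln (\<Prod>p\<in>?P. real p ^ (n div p)) = (\<Sum>p\<in>?P. real (n div p) * ln (real p))"
    by (subst ln_prod) (auto simp: prime_gt_0_nat ln_realpow)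
  finally have up: "(\<Sum>p\<in>?P. real (n div p) * ln (real p)) \<le> real n * ln (real n)" .
  have "(\<Sum>p\<in>?P. real n / 2 * (ln (real p) / real p)) \<le> (\<Sum>p\<in>?P. real (n div p) * ln (real p))"
  proof (rule sum_mono)
    fix p assume p: "p \<in> ?P"
    then have "p > 0" by (auto simp: prime_gt_0_nat)
    have "n div p \<ge> 1" using p \<open>p > 0\<close> by (simp add: div_greater_zero_iff Suc_leI)
    have "n = p * (n div p) + n mod p" by simp
    also have "\<dots> \<le> p * (n div p) + p * (n div p)"
    proof (rule add_left_mono)
      have "n mod p \<le> p * 1" using mod_less_divisor[OF \<open>p > 0\<close>, of n] by simp
      also have "\<dots> \<le> p * (n div p)" using \<open>n div p \<ge> 1\<close> by (rule mult_le_mono2)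
      finally show "n mod p \<le> p * (n div p)" .
    qed
    finally have "real n \<le> real (p * (n div p) + p * (n div p))" by (rule of_nat_mono)
    then have "real n / 2 / real p \<le> real (n div p)" using \<open>p > 0\<close> by (simp add: field_simps)
    moreover have "ln (real p) \<ge> 0" using \<open>p > 0\<close> by simp
    ultimately have "real n / 2 / real p * ln (real p) \<le> real (n div p) * ln (real p)"
      by (intro mult_right_mono)
    then show "real n / 2 * (ln (real p) / real p) \<le> real (n div p) * ln (real p)" by simp
  qed
  then have "real n / 2 * (\<Sum>p\<in>?P. ln (real p) / real p) \<le> real n * ln (real n)"
    using up by (simp add: sum_distrib_left)
  then show ?thesis using assms by (simp add: field_simps)
qed

section \<open>The character modulo 4 and its divisor sums\<close>

definition chi4 :: "nat \<Rightarrow> real" where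
  "chi4 n = (if n mod 4 = 1 then 1 else if n mod 4 = 3 then - 1 else 0)"

lemma chi4_1: "chi4 1 = 1" "chi4 (Suc 0) = 1" by (simp_all add: chi4_def)

lemma chi4_mult: "chi4 (a * b) = chi4 a * chi4 b"
proof -
  have *: "chi4 n = chi4 (n mod 4)" for n by (simp add: chi4_def)
  have "a mod 4 = 0 \<or> a mod 4 = 1 \<or> a mod 4 = 2 \<or> a mod 4 = 3"
    "b mod 4 = 0 \<or> b mod 4 = 1 \<or> b mod 4 = 2 \<or> b mod 4 = 3" by presburger+
  moreover have "chi4 (a * b) = chi4 ((a mod 4) * (b mod 4))"
    by (simp only: chi4_def mod_mult_eq)
  ultimately show ?thesis
    unfolding *[of a] *[of b] by (elim disjE) (simp_all add: chi4_def)
qed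

lemma chi4_power: "chi4 (a ^ k) = chi4 a ^ k"
  by (induction k) (simp_all add: chi4_mult chi4_1)

text \<open>The partial sums of 1 - 1/3 + 1/5 - ... alternate with shrinking steps, so they stay
  between the first two values, 1 and 2/3.\<close>

lemma chi4_partial_sum_bounds:
  assumes "n \<ge> 1"
  shows "2 / 3 \<le> (\<Sum>d=1..n. chi4 d / real d)" "(\<Sum>d=1..n. chi4 d / real d) \<le> 1"
proof -
  define L where "L n = (\<Sum>d=1..n. chi4 d / real d)" for n
  have Suc: "L (Suc n) = L n + chi4 (Suc n) / real (Suc n)" for n by (simp add: L_def)
  have step: "L (4 * k + 4) = L (4 * k + 3)" "L (4 * k + 5) = L (4 * k + 3) + 1 / real (4 * k + 5)"
     "L (4 * k + 6) = L (4 * k + 3) + 1 / real (4 * k + 5)"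
     "L (4 * k + 7) = L (4 * k + 3) + 1 / real (4 * k + 5) - 1 / real (4 * k + 7)" for k
  proof -
    have m: "(4 * k + 4) mod 4 = 0" "(4 * k + 5) mod 4 = 1" "(4 * k + 6) mod 4 = 2" "(4 * k + 7) mod 4 = 3"
      by presburger+
    have s: "Suc (4 * k + 3) = 4 * k + 4" "Suc (4 * k + 4) = 4 * k + 5" "Suc (4 * k + 5) = 4 * k + 6"
      "Suc (4 * k + 6) = 4 * k + 7" by simp_all
    have c: "chi4 (4 * k + 4) = 0" "chi4 (4 * k + 5) = 1" "chi4 (4 * k + 6) = 0" "chi4 (4 * k + 7) = - 1"
      unfolding chi4_def m by simp_all
    note S = Suc[of "4 * k + 3", unfolded s c] Suc[of "4 * k + 4", unfolded s c]
      Suc[of "4 * k + 5", unfolded s c] Suc[of "4 * k + 6", unfolded s c]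
    show "L (4 * k + 4) = L (4 * k + 3)" "L (4 * k + 5) = L (4 * k + 3) + 1 / real (4 * k + 5)"
     "L (4 * k + 6) = L (4 * k + 3) + 1 / real (4 * k + 5)"
     "L (4 * k + 7) = L (4 * k + 3) + 1 / real (4 * k + 5) - 1 / real (4 * k + 7)"
      using S by linarith+
  qed
  have "{1..2::nat} = {1, 2}" "{1..3::nat} = {1, 2, 3}" by auto
  then have base: "L 1 = 1" "L 2 = 1" "L 3 = 2 / 3"
    by (simp_all add: L_def chi4_def)
  have le: "1 / real (i + k) \<le> 1 / real (i + j)" if "j \<le> k" "i + j > 0" for i j k
    using that by (intro divide_left_mono mult_pos_pos) auto
  \<comment> \<open>The upper bound is strengthened by the last subtracted term, so that it survives
    adding the next, smaller, positive term.\<close>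
  have inv: "2 / 3 \<le> L (4 * k + 3) \<and> L (4 * k + 3) + 1 / real (4 * k + 3) \<le> 1" for k
  proof (induction k)
    case 0
    show ?case using base by simp
  next
    case (Suc k)
    have "4 * Suc k + 3 = 4 * k + 7" by simp
    moreover have "1 / real (4 * k + 7) \<le> 1 / real (4 * k + 5)" "1 / real (4 * k + 5) \<le> 1 / real (4 * k + 3)"
      by (rule le; simp)+
    moreover have "L (4 * k + 7) = L (4 * k + 3) + 1 / real (4 * k + 5) - 1 / real (4 * k + 7)"
      by (rule step)
    ultimately show ?case using Suc by (simp only:) linarith
  qed
  have "2 / 3 \<le> L n \<and> L n \<le> 1"
  proof (cases "n \<le> 3")
    case True
    then have "n = 1 \<or> n = 2 \<or> n = 3" using assms by linarith
    then show ?thesis using base by auto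
  next
    case False
    then have "n div 4 \<ge> 1" by (simp add: div_greater_zero_iff Suc_le_eq)
    then obtain k where "n div 4 = Suc k" by (metis Suc_le_D One_nat_def)
    moreover have "n = 4 * (n div 4) + n mod 4" by simp
    moreover have "n mod 4 < 4" by simp
    ultimately have n: "n = 4 * k + 4 \<or> n = 4 * k + 5 \<or> n = 4 * k + 6 \<or> n = 4 * k + 7" by linarith
    moreover have "0 \<le> 1 / real (4 * k + 7)" "0 \<le> 1 / real (4 * k + 5)" "1 / real (4 * k + 5) \<le> 1 / real (4 * k + 3)" "0 \<le> 1 / real (4 * k + 3)"
      using le[of 3 5 "4 * k"] by simp_all
    moreover have "2 / 3 \<le> L (4 * k + 7)"
      using inv[of "Suc k"] by (simp add: add.commute)
    ultimately have "(2 / 3 \<le> L (4 * k + 4) \<and> L (4 * k + 4) \<le> 1) \<and> (2 / 3 \<le> L (4 * k + 5) \<and> L (4 * k + 5) \<le> 1) \<and>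
      (2 / 3 \<le> L (4 * k + 6) \<and> L (4 * k + 6) \<le> 1) \<and> (2 / 3 \<le> L (4 * k + 7) \<and> L (4 * k + 7) \<le> 1)"
      using inv[of k] step[of k] by (intro conjI; linarith)
    then show ?thesis using n by (elim disjE) simp_all
  qed
  then show "2 / 3 \<le> (\<Sum>d=1..n. chi4 d / real d)" "(\<Sum>d=1..n. chi4 d / real d) \<le> 1"
    by (simp_all add: L_def)
qed

text \<open>For \<open>n > 0\<close> this is a quarter of the number of representations of
  \<open>n\<close> as a sum of two squares.\<close>

definition chi4_divisor_sum :: "nat \<Rightarrow> real" where
  "chi4_divisor_sum n = (\<Sum>d | d dvd n. chi4 d)"

text \<open>Writing \<open>n = m * d\<close> turns the inner sum into a truncation of the series for
  \<open>L(1, chi4)\<close>.\<close>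

lemma sum_chi4_divisor_sum_over_n:
  "(\<Sum>n=1..N. chi4_divisor_sum n / real n) = (\<Sum>m=1..N. 1 / real m * (\<Sum>d=1..N div m. chi4 d / real d))"
proof -
  have "(\<Sum>n=1..N. chi4_divisor_sum n / real n) = (\<Sum>n=1..N. \<Sum>d | d dvd n. chi4 d / real n)"
    by (simp add: chi4_divisor_sum_def sum_divide_distrib)
  also have "\<dots> = (\<Sum>(n, d)\<in>(SIGMA n:{1..N}. {d. d dvd n}). chi4 d / real n)"
    by (intro sum.Sigma) auto
  also have "\<dots> = (\<Sum>(m, d)\<in>(SIGMA m:{1..N}. {1..N div m}). 1 / real m * (chi4 d / real d))"
  proof (rule sum.reindex_bij_witness[of _ "\<lambda>(m, d). (m * d, d)" "\<lambda>(n, d). (n div d, d)"])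
    fix x assume "x \<in> (SIGMA n:{1..N}. {d. d dvd n})"
    then obtain n d where x: "x = (n, d)" "1 \<le> n" "n \<le> N" "d dvd n" by auto
    then obtain m where m: "n = d * m" by blast
    have pos: "d > 0" "m > 0" using x(2) unfolding m by (auto intro: Nat.gr0I)
    have nd: "n div d = m" using pos by (simp add: m)
    have "m \<le> n" using pos by (simp add: m)
    then have "m \<le> N" using x(3) by (rule le_trans)
    moreover have "d \<le> N div m" using x(3) m pos by (simp add: less_eq_div_iff_mult_less_eq)
    ultimately show "(case x of (n, d) \<Rightarrow> (n div d, d)) \<in> (SIGMA m:{1..N}. {1..N div m})"
      using pos by (simp add: x(1) nd Suc_le_eq)
    show "(case case x of (n, d) \<Rightarrow> (n div d, d) of (m, d) \<Rightarrow> (m * d, d)) = x"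
      by (simp add: x(1) nd) (simp add: m)
    show "(case case x of (n, d) \<Rightarrow> (n div d, d) of (m, d) \<Rightarrow> 1 / real m * (chi4 d / real d)) =
         (case x of (n, d) \<Rightarrow> chi4 d / real n)"
      by (simp add: x(1) nd) (simp add: m)
  next
    fix y assume "y \<in> (SIGMA m:{1..N}. {1..N div m})"
    then obtain m d where y: "y = (m, d)" "1 \<le> m" "m \<le> N" "1 \<le> d" "d \<le> N div m" by auto
    then have "m * d \<le> N" by (simp add: less_eq_div_iff_mult_less_eq mult.commute)
    then show "(case y of (m, d) \<Rightarrow> (m * d, d)) \<in> (SIGMA n:{1..N}. {d. d dvd n})"
      using y(2,4) by (simp add: y(1) Suc_le_eq)
    show "(case case y of (m, d) \<Rightarrow> (m * d, d) of (n, d) \<Rightarrow> (n div d, d)) = y"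
      using y(4) by (simp add: y(1))
  qed
  also have "\<dots> = (\<Sum>m=1..N. \<Sum>d=1..N div m. 1 / real m * (chi4 d / real d))"
    by (intro sum.Sigma[symmetric]) auto
  finally show ?thesis by (simp only: sum_distrib_left)
qed

text \<open>Positivity of \<open>L(1, chi4)\<close> enters here in explicit form: every nonempty
  truncation lies between 2/3 and 1, so no error term arises.\<close>

lemma sum_chi4_divisor_sum_over_n_bounds:
  "2 / 3 * harm N \<le> (\<Sum>n=1..N. chi4_divisor_sum n / real n)"
  "(\<Sum>n=1..N. chi4_divisor_sum n / real n) \<le> harm N"
proof -
  have b: "2 / 3 \<le> (\<Sum>d=1..N div m. chi4 d / real d) \<and> (\<Sum>d=1..N div m. chi4 d / real d) \<le> 1"
    if "m \<in> {1..N}" for m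
  proof -
    have "N div m \<ge> 1" using that by (simp add: div_greater_zero_iff Suc_le_eq)
    then show ?thesis using chi4_partial_sum_bounds by blast
  qed
  have "2 / 3 * harm N = (\<Sum>m=1..N. 1 / real m * (2 / 3))"
    unfolding harm_def sum_distrib_left by (intro sum.cong refl) (simp add: inverse_eq_divide)
  also have "\<dots> \<le> (\<Sum>n=1..N. chi4_divisor_sum n / real n)"
    unfolding sum_chi4_divisor_sum_over_n by (rule sum_mono, rule mult_left_mono) (use b in \<open>blast, simp\<close>)
  finally show "2 / 3 * harm N \<le> (\<Sum>n=1..N. chi4_divisor_sum n / real n)" .
  have "(\<Sum>n=1..N. chi4_divisor_sum n / real n) \<le> (\<Sum>m=1..N. 1 / real m * 1)"
    unfolding sum_chi4_divisor_sum_over_n by (rule sum_mono, rule mult_left_mono) (use b in \<open>blast, simp\<close>)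
  then show "(\<Sum>n=1..N. chi4_divisor_sum n / real n) \<le> harm N"
    by (simp add: harm_def inverse_eq_divide)
qed

text \<open>Every divisor of \<open>p ^ k * m\<close> is uniquely \<open>p ^ i * d\<close> with
  \<open>i \<le> k\<close> and \<open>d dvd m\<close>; the multiplicity of \<open>p\<close> recovers
  \<open>i\<close>.\<close>

lemma chi4_divisor_sum_prime_power_mult:
  assumes "prime p" "\<not> p dvd m"
  shows "chi4_divisor_sum (p ^ k * m) = (\<Sum>i\<le>k. chi4 p ^ i) * chi4_divisor_sum m"
proof -
  have "bij_betw (\<lambda>(i, d). p ^ i * d) ({..k} \<times> {d. d dvd m}) {d. d dvd p ^ k * m}"
  proof (rule bij_betwI')
    fix x y assume xy: "x \<in> {..k} \<times> {d. d dvd m}" "y \<in> {..k} \<times> {d. d dvd m}"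
    obtain i d j e where [simp]: "x = (i, d)" "y = (j, e)" by (cases x, cases y)
    have nd: "\<not> p dvd d" "\<not> p dvd e" using xy assms(2) dvd_trans by auto
    have mult: "multiplicity p (p ^ i * d) = i" if "\<not> p dvd d" for i d
    proof -
      have "d \<noteq> 0" "p \<noteq> 0" using that assms(1) by (auto intro: Nat.gr0I)
      then show ?thesis
        using that assms(1) by (subst prime_elem_multiplicity_mult_distrib) (auto simp: not_dvd_imp_multiplicity_0)
    qed
    have "i = j" if "p ^ i * d = p ^ j * e"
      using mult[OF nd(1), of i] mult[OF nd(2), of j] that by simp
    then show "(case x of (i, d) \<Rightarrow> p ^ i * d) = (case y of (i, d) \<Rightarrow> p ^ i * d) \<longleftrightarrow> x = y"
      using assms(1) prime_gt_0_nat[of p] by auto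
  next
    fix x assume "x \<in> {..k} \<times> {d. d dvd m}"
    then show "(case x of (i, d) \<Rightarrow> p ^ i * d) \<in> {d. d dvd p ^ k * m}"
      by (auto intro: mult_dvd_mono le_imp_power_dvd)
  next
    fix c assume "c \<in> {d. d dvd p ^ k * m}"
    then obtain a b where ab: "c = a * b" "a dvd p ^ k" "b dvd m" using division_decomp by blast
    then obtain i where "i \<le> k" "a = p ^ i" using divides_primepow_nat[OF assms(1)] by blast
    then show "\<exists>x\<in>{..k} \<times> {d. d dvd m}. c = (case x of (i, d) \<Rightarrow> p ^ i * d)" using ab by auto
  qed
  from sum.reindex_bij_betw[OF this, of chi4, symmetric]
  have "chi4_divisor_sum (p ^ k * m) = (\<Sum>(i, d)\<in>{..k} \<times> {d. d dvd m}. chi4 p ^ i * chi4 d)"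
    by (simp add: chi4_divisor_sum_def chi4_mult chi4_power case_prod_beta)
  then show ?thesis by (simp add: chi4_divisor_sum_def sum_product sum.cartesian_product)
qed

lemma chi4_cases: "chi4 n = - 1 \<or> chi4 n = 0 \<or> chi4 n = 1"
  by (simp add: chi4_def)

lemma geometric_sum_nonneg:
  fixes c :: real
  assumes "c = - 1 \<or> c = 0 \<or> c = 1"
  shows "0 \<le> (\<Sum>i\<le>k. c ^ i)"
proof -
  have "(\<Sum>i\<le>k. (- 1 :: real) ^ i) = (if even k then 1 else 0)" by (induction k) auto
  then show ?thesis using assms by (elim disjE) (auto intro!: sum_nonneg)
qed

text \<open>Multiplicativity reduces this to prime powers, where the value is
  \<open>1 + c + ... + c ^ k\<close> with \<open>c\<close> one of -1, 0, 1. Nonnegativity is what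
  later permits enlarging ranges of summation.\<close>

lemma chi4_divisor_sum_nonneg: "n > 0 \<Longrightarrow> chi4_divisor_sum n \<ge> 0"
proof (induction n rule: less_induct)
  case (less n)
  show ?case
  proof (cases "n = 1")
    case True
    then show ?thesis by (simp add: chi4_divisor_sum_def chi4_1)
  next
    case False
    then obtain p where p: "prime p" "p dvd n" using prime_factor_nat by blast
    obtain m where m: "n = p ^ multiplicity p n * m" "\<not> p dvd m"
      using multiplicity_decompose'[of n p] p less.prems by (metis less_numeral_extra(3) not_prime_unit)
    have "m > 0" using less.prems m(1) by (metis mult_0_right neq0_conv)
    have "n \<noteq> m" using p m by auto
    moreover have "m \<le> n" using less.prems m(1) by (metis dvd_imp_le dvd_triv_right)
    ultimately have "chi4_divisor_sum m \<ge> 0" using less.IH[of m] \<open>m > 0\<close> by simp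
    then show ?thesis
      using chi4_divisor_sum_prime_power_mult[OF p(1) m(2), of "multiplicity p n"] m(1)
        geometric_sum_nonneg[OF chi4_cases[of p], of "multiplicity p n"] by simp
  qed
qed

text \<open>The right side is the generating function in \<open>t\<close> of nonnegative
  coefficients, so its partial sums stay below it. An exact formula for the remainder stands in for
  convergence.\<close>

lemma local_euler_factor_le:
  fixes c t :: real
  assumes c: "c = - 1 \<or> c = 0 \<or> c = 1" and t: "0 \<le> t" "t < 1"
  shows "(\<Sum>k\<le>K. (\<Sum>i\<le>k. c ^ i) * t ^ k) \<le> 1 / ((1 - t) * (1 - c * t))"
proof -
  define a where "a k = (\<Sum>i\<le>k. c ^ i)" for k
  have a_nonneg: "a k \<ge> 0" for k unfolding a_def by (rule geometric_sum_nonneg[OF c])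
  have a_Suc: "a (Suc k) = a k + c ^ Suc k" for k by (simp add: a_def)
  have a_Suc': "a (Suc k) = 1 + c * a k" for k
  proof (induction k)
    case (Suc k)
    have "c * a (Suc k) = c * a k + c * c ^ Suc k" by (simp add: a_Suc algebra_simps)
    then show ?case using Suc a_Suc[of "Suc k"] by simp
  qed (simp add: a_def)
  \<comment> \<open>Multiplying by the denominator telescopes because
    \<open>a (k + 2) = (1 + c) * a (k + 1) - c * a k\<close>; only two boundary terms
    remain.\<close>
  have "(1 - t) * (1 - c * t) * (\<Sum>k\<le>K. a k * t ^ k) = 1 - a (Suc K) * t ^ Suc K + c * a K * t ^ (K + 2)"
  proof (induction K)
    case 0
    show ?case by (simp add: a_def algebra_simps power2_eq_square)
  next
    case (Suc K)
    have rec: "a (Suc (Suc K)) = (1 + c) * a (Suc K) - c * a K"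
      using a_Suc'[of "Suc K"] a_Suc'[of K] by (simp add: algebra_simps)
    have "(1 - t) * (1 - c * t) * (\<Sum>k\<le>Suc K. a k * t ^ k) =
        1 - a (Suc K) * t ^ Suc K + c * a K * t ^ (K + 2) + (1 - t) * (1 - c * t) * (a (Suc K) * t ^ Suc K)"
      by (simp only: sum.atMost_Suc distrib_left Suc)
    also have "\<dots> = 1 - a (Suc (Suc K)) * t ^ Suc (Suc K) + c * a (Suc K) * t ^ (Suc K + 2)"
      by (simp add: rec algebra_simps)
    finally show ?case .
  qed
  also have "\<dots> \<le> 1"
  proof -
    have "c * a K * t \<le> a (Suc K)"
    proof (cases "c * a K \<ge> 0")
      case True
      then have "c * a K * t \<le> c * a K * 1" using t by (intro mult_left_mono) auto
      then show ?thesis by (simp add: a_Suc')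
    next
      case False
      then have "c * a K * t \<le> 0" using t by (simp add: mult_nonpos_nonneg)
      then show ?thesis using a_nonneg[of "Suc K"] by linarith
    qed
    then have "c * a K * t * t ^ Suc K \<le> a (Suc K) * t ^ Suc K"
      using t by (intro mult_right_mono) auto
    then show ?thesis by (simp add: mult_ac)
  qed
  finally have "(\<Sum>k\<le>K. a k * t ^ k) * ((1 - t) * (1 - c * t)) \<le> 1" by (simp only: mult.commute)
  moreover have "c * t \<le> 1 * t" using c t by (intro mult_right_mono) auto
  then have "(1 - t) * (1 - c * t) > 0" using t by (intro mult_pos_pos) auto
  ultimately show ?thesis unfolding a_def by (subst pos_le_divide_eq)
qed

text \<open>Induction over the primes: each \<open>n\<close> splits as \<open>p ^ k * m\<close> with
  \<open>m\<close> prime to \<open>p\<close>, so \<open>A\<close> lies in the image of a product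
  set, over which the sum factors. The enlargement only increases the sum, as the terms are
  nonnegative.\<close>

lemma smooth_sum_le_euler_product:
  assumes "finite P" "\<And>p. p \<in> P \<Longrightarrow> prime p" "finite A"
    and "\<And>n. n \<in> A \<Longrightarrow> n > 0 \<and> prime_factors n \<subseteq> P"
  shows "(\<Sum>n\<in>A. chi4_divisor_sum n / real n) \<le> (\<Prod>p\<in>P. 1 / ((1 - 1 / real p) * (1 - chi4 p * (1 / real p))))"
  using assms
proof (induction P arbitrary: A rule: finite_induct)
  case empty
  have "A \<subseteq> {1}"
  proof
    fix n assume "n \<in> A"
    then have "n > 0" "prime_factors n = {}" using empty.prems(3) by auto
    then show "n \<in> {1}" by (auto simp: prime_factorization_empty_iff)
  qed
  then have "A = {} \<or> A = {1}" by auto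
  then show ?case by (auto simp: chi4_divisor_sum_def chi4_1)
next
  case (insert p P)
  have p: "prime p" using insert.prems(1) by simp
  then have p1: "real p > 1" using prime_gt_1_nat by simp
  define f where "f n = chi4_divisor_sum n / real n" for n
  define t where "t = 1 / real p"
  define u where "u n = n div p ^ multiplicity p n" for n
  \<comment> \<open>Inserting 0 keeps the maximum defined for empty \<open>A\<close>.\<close>
  define K where "K = Max (insert 0 (multiplicity p ` A))"
  let ?B = "1 / ((1 - 1 / real p) * (1 - chi4 p * (1 / real p)))"
  have u: "n = p ^ multiplicity p n * u n" "\<not> p dvd u n" "u n > 0" "prime_factors (u n) \<subseteq> P" if "n \<in> A" for n
  proof -
    have n: "n > 0" "prime_factors n \<subseteq> insert p P" using insert.prems(3)[OF that] by auto
    have d: "p ^ multiplicity p n dvd n" by (rule multiplicity_dvd)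
    then show 1: "n = p ^ multiplicity p n * u n" by (simp add: u_def)
    show 2: "\<not> p dvd u n" unfolding u_def
      using n p not_prime_unit by (intro multiplicity_decompose) auto
    show 3: "u n > 0" using n 1 by (metis mult_0_right neq0_conv)
    have "prime_factors (u n) \<subseteq> prime_factors n"
    proof (rule dvd_prime_factors)
      show "u n dvd n" using 1 dvd_triv_right by metis
    qed (use n in simp)
    then show "prime_factors (u n) \<subseteq> P" using n 2 by (auto simp: in_prime_factors_iff)
  qed
  have mK: "multiplicity p n \<le> K" if "n \<in> A" for n
    unfolding K_def using that insert.prems(2) by (intro Max_ge) auto
  have fpk: "f (p ^ k * m) = ((\<Sum>i\<le>k. chi4 p ^ i) * t ^ k) * f m" if "\<not> p dvd m" for k m
    using chi4_divisor_sum_prime_power_mult[OF p that, of k] by (simp add: f_def t_def power_divide)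
  let ?I = "{..K} \<times> u ` A" and ?\<phi> = "\<lambda>(k, m). p ^ k * m"
  have f_nonneg: "f (?\<phi> x) \<ge> 0" if "x \<in> ?I" for x
    using that u p1 by (auto simp: f_def intro!: divide_nonneg_nonneg chi4_divisor_sum_nonneg)
  have "sum f A \<le> sum f (?\<phi> ` ?I)"
  proof (rule sum_mono2)
    show "finite (?\<phi> ` ?I)" using insert.prems(2) by simp
    show "A \<subseteq> ?\<phi> ` ?I"
    proof
      fix n assume n: "n \<in> A"
      then have "(multiplicity p n, u n) \<in> ?I" using mK by auto
      moreover have "n = ?\<phi> (multiplicity p n, u n)" using u(1)[OF n] by simp
      ultimately show "n \<in> ?\<phi> ` ?I" by (rule rev_image_eqI)
    qed
    show "0 \<le> f b" if "b \<in> ?\<phi> ` ?I - A" for b using that f_nonneg by blast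
  qed
  also have "\<dots> \<le> sum (f \<circ> ?\<phi>) ?I"
    using insert.prems(2) f_nonneg by (intro sum_image_le) auto
  also have "\<dots> = (\<Sum>(k, m)\<in>?I. ((\<Sum>i\<le>k. chi4 p ^ i) * t ^ k) * f m)"
    using u(2) by (intro sum.cong refl) (auto simp: fpk)
  also have "\<dots> = (\<Sum>k\<le>K. (\<Sum>i\<le>k. chi4 p ^ i) * t ^ k) * (\<Sum>m\<in>u ` A. f m)"
    by (simp add: sum_product sum.cartesian_product)
  also have "\<dots> \<le> ?B * (\<Prod>p\<in>P. 1 / ((1 - 1 / real p) * (1 - chi4 p * (1 / real p))))"
  proof (rule mult_mono)
    show "(\<Sum>k\<le>K. (\<Sum>i\<le>k. chi4 p ^ i) * t ^ k) \<le> ?B"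
      using local_euler_factor_le[OF chi4_cases, of t p K] p1 by (simp add: t_def)
    show "(\<Sum>m\<in>u ` A. f m) \<le> (\<Prod>p\<in>P. 1 / ((1 - 1 / real p) * (1 - chi4 p * (1 / real p))))"
      unfolding f_def
    proof (rule insert.IH)
      show "n > 0 \<and> prime_factors n \<subseteq> P" if "n \<in> u ` A" for n using that u(3,4) by blast
    qed (use insert.prems in auto)
    show "0 \<le> (\<Sum>m\<in>u ` A. f m)"
      using u(3) by (intro sum_nonneg) (auto simp: f_def intro!: divide_nonneg_nonneg chi4_divisor_sum_nonneg)
    have "chi4 p * (1 / real p) \<le> 1 * (1 / real p)"
      using chi4_cases[of p] by (intro mult_right_mono) auto
    also have "\<dots> < 1" using p1 by simp
    finally show "0 \<le> ?B" using p1 by (intro divide_nonneg_nonneg mult_nonneg_nonneg) auto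
  qed
  finally show ?case using insert.hyps by (simp add: f_def)
qed

text \<open>\<open>1 / n\<^sup>2 \<le> 1 / ((n - 2) * (n + 2))\<close>, and the right side
  telescopes in steps of 4. The residue condition saves a factor 4, which makes the values 1/4 for
  \<open>r = 3\<close> and 1/12 for \<open>r = 5\<close> small enough below.\<close>

lemma sum_inverse_square_residue_le:
  assumes "finite A" "r \<ge> 3" "\<And>n. n \<in> A \<Longrightarrow> n \<ge> r \<and> n mod 4 = r mod (4::nat)"
  shows "(\<Sum>n\<in>A. 1 / (real n)\<^sup>2) \<le> 1 / (4 * (real r - 2))"
proof -
  have tele: "(\<Sum>k<K. 1 / (real (r + 4 * k))\<^sup>2) \<le> 1 / 4 * (1 / (real r - 2) - 1 / (real (r + 4 * K) - 2))" for K
  proof (induction K)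
    case (Suc K)
    define x where "x = real (r + 4 * K)"
    have x: "x \<ge> 3" using assms(2) by (simp add: x_def)
    have x': "real (r + 4 * Suc K) = x + 4" by (simp add: x_def)
    have "3 * 3 \<le> x * x" using x by (intro mult_mono) auto
    then have "1 / x\<^sup>2 \<le> 1 / ((x - 2) * (x + 2))"
      using x by (intro divide_left_mono) (auto simp: algebra_simps power2_eq_square intro!: mult_pos_pos)
    also have "\<dots> = 1 / 4 * (1 / (x - 2) - 1 / (x + 2))" using x by (simp add: field_simps)
    finally have "1 / x\<^sup>2 \<le> 1 / 4 * (1 / (x - 2) - 1 / (x + 4 - 2))" by (simp add: add.commute)
    moreover have "(\<Sum>k<Suc K. 1 / (real (r + 4 * k))\<^sup>2) = (\<Sum>k<K. 1 / (real (r + 4 * k))\<^sup>2) + 1 / x\<^sup>2"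
      by (simp add: x_def)
    moreover note Suc[folded x_def]
    moreover have "S' \<le> 1 / 4 * (a - d)" if "u \<le> 1 / 4 * (b - d)" "S' = S + u" "S \<le> 1 / 4 * (a - b)"
      for a b d u S S' :: real
      using add_mono[OF that(3,1)] that(2) by (simp flip: add_divide_distrib)
    ultimately show ?case unfolding x' by blast
  qed simp
  have "A \<subseteq> (\<lambda>k. r + 4 * k) ` {..<Suc (Max (insert 0 A))}"
  proof
    fix n assume n: "n \<in> A"
    have "4 dvd n - r" using assms(3)[OF n] by (metis mod_eq_dvd_iff_nat)
    then obtain k where "n - r = 4 * k" by blast
    then have "n = r + 4 * k" using assms(3)[OF n] by linarith
    moreover have "n \<le> Max (insert 0 A)" using n assms(1) by (intro Max_ge) auto
    ultimately show "n \<in> (\<lambda>k. r + 4 * k) ` {..<Suc (Max (insert 0 A))}" by auto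
  qed
  then have "(\<Sum>n\<in>A. 1 / (real n)\<^sup>2) \<le> (\<Sum>n\<in>(\<lambda>k. r + 4 * k) ` {..<Suc (Max (insert 0 A))}. 1 / (real n)\<^sup>2)"
    by (intro sum_mono2) auto
  also have "\<dots> = (\<Sum>k<Suc (Max (insert 0 A)). 1 / (real (r + 4 * k))\<^sup>2)"
    by (subst sum.reindex) (auto simp: inj_on_def)
  also have "\<dots> \<le> 1 / 4 * (1 / (real r - 2) - 1 / (real (r + 4 * Suc (Max (insert 0 A))) - 2))"
    by (rule tele)
  also have "\<dots> \<le> 1 / 4 * (1 / (real r - 2))"
  proof -
    have "0 \<le> 1 / (real (r + 4 * Suc (Max (insert 0 A))) - 2)" using assms(2) by (intro divide_nonneg_nonneg) linarith+
    moreover have "1 / 4 * (b - d) \<le> 1 / 4 * b" if "0 \<le> d" for b d :: real using that by simp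
    ultimately show ?thesis by blast
  qed
  finally show ?thesis by simp
qed

section \<open>Products over the primes congruent to 1 modulo 4\<close>

definition primes_1mod4 :: "nat \<Rightarrow> nat set" where
  "primes_1mod4 y = {p. prime p \<and> p mod 4 = 1 \<and> p \<le> y}"

lemma finite_primes_1mod4: "finite (primes_1mod4 y)"
  by (rule finite_subset[of _ "{..y}"]) (auto simp: primes_1mod4_def)

lemma primes_1mod4D:
  assumes "p \<in> primes_1mod4 y"
  shows "prime p" "p mod 4 = 1" "p \<ge> 5" "p \<le> y" "chi4 p = 1"
proof -
  show *: "prime p" "p mod 4 = 1" "p \<le> y" using assms by (auto simp: primes_1mod4_def)
  then show "chi4 p = 1" by (simp add: chi4_def)
  have "p > 1" using * prime_gt_1_nat by blast
  then show "p \<ge> 5" using *(2) by presburger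
qed

text \<open>The partial sum up to \<open>y\<close>, at least \<open>2 / 3 * ln y\<close>, is below
  the Euler product over primes up to \<open>y\<close>. There a prime 1 modulo 4 contributes
  \<open>1 / (1 - 1 / p)\<^sup>2\<close>, the prime 2 contributes 2, and all primes 3 modulo 4
  together at most 2, their inverse squares summing to at most 1/4.\<close>

lemma prod_primes_1mod4_upper:
  assumes "y \<ge> 2"
  shows "(\<Prod>p\<in>primes_1mod4 y. 1 - 1 / real p)\<^sup>2 \<le> 6 / ln (real y)"
proof -
  define P3 where "P3 = {p. prime p \<and> p mod 4 = 3 \<and> p \<le> y}"
  let ?P1 = "primes_1mod4 y" and ?P = "{p. prime p \<and> p \<le> y}"
  let ?F = "\<lambda>p. 1 / ((1 - 1 / real p) * (1 - chi4 p * (1 / real p)))"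
  define E1 where "E1 = (\<Prod>p\<in>?P1. 1 - 1 / real p)"
  define E3 where "E3 = (\<Prod>p\<in>P3. 1 - 1 / (real p)\<^sup>2)"
  have fin: "finite ?P1" "finite P3" "finite ?P"
    by (auto simp: finite_primes_1mod4 P3_def intro: finite_subset[of _ "{..y}"])
  have split: "?P = insert 2 (?P1 \<union> P3)"
  proof (rule equalityI; rule subsetI)
    fix p assume p: "p \<in> ?P"
    show "p \<in> insert 2 (?P1 \<union> P3)"
    proof (cases "p = 2")
      case False
      then have "odd p" using p prime_odd_nat[of p] prime_ge_2_nat[of p] by force
      then have "p mod 4 = 1 \<or> p mod 4 = 3" by presburger
      then show ?thesis using p by (auto simp: primes_1mod4_def P3_def)
    qed simp
  qed (use assms in \<open>auto simp: primes_1mod4_def P3_def\<close>)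
  have F1: "(\<Prod>p\<in>?P1. ?F p) = 1 / E1\<^sup>2"
  proof -
    have "(\<Prod>p\<in>?P1. ?F p) = (\<Prod>p\<in>?P1. 1 / (1 - 1 / real p)\<^sup>2)"
      by (intro prod.cong refl) (simp add: primes_1mod4D(5) power2_eq_square)
    then show ?thesis by (simp add: E1_def prod_dividef prod_power_distrib)
  qed
  have F3: "(\<Prod>p\<in>P3. ?F p) = 1 / E3"
  proof -
    have "(\<Prod>p\<in>P3. ?F p) = (\<Prod>p\<in>P3. 1 / (1 - 1 / (real p)\<^sup>2))"
      by (intro prod.cong refl) (auto simp: P3_def chi4_def power2_eq_square algebra_simps)
    then show ?thesis by (simp add: E3_def prod_dividef)
  qed
  have prime_notin: "2 \<notin> ?P1 \<union> P3" "?P1 \<inter> P3 = {}" by (auto simp: primes_1mod4_def P3_def)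
  have prod: "(\<Prod>p\<in>?P. ?F p) = 2 * (1 / E1\<^sup>2) * (1 / E3)"
  proof -
    have "(\<Prod>p\<in>?P. ?F p) = ?F 2 * (\<Prod>p\<in>?P1 \<union> P3. ?F p)"
      unfolding split using fin prime_notin by (subst prod.insert) auto
    also have "(\<Prod>p\<in>?P1 \<union> P3. ?F p) = (1 / E1\<^sup>2) * (1 / E3)"
      unfolding F1[symmetric] F3[symmetric] using fin prime_notin by (intro prod.union_disjoint) auto
    also have "?F 2 = 2" by (simp add: chi4_def)
    finally show ?thesis by simp
  qed
  have E1: "E1 > 0" unfolding E1_def
    by (intro prod_pos) (auto dest: primes_1mod4D)
  have E3: "E3 \<ge> 1 / 2"
  proof -
    have p3: "p \<ge> 3 \<and> p mod 4 = 3 mod 4" if "p \<in> P3" for p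
      using that mod_less_eq_dividend[of p 4] by (auto simp: P3_def)
    then have "(\<Sum>p\<in>P3. 1 / (real p)\<^sup>2) \<le> 1 / (4 * (real 3 - 2))"
      using fin by (intro sum_inverse_square_residue_le) auto
    moreover have "1 - (\<Sum>p\<in>P3. 1 / (real p)\<^sup>2) \<le> E3" unfolding E3_def
    proof (rule Weierstrass_prod_ineq)
      fix p assume "p \<in> P3"
      then have "real p \<ge> 1" using p3 by force
      then show "1 / (real p)\<^sup>2 \<in> {0..1}" by simp
    qed
    ultimately show ?thesis by simp
  qed
  have "(\<Sum>n=1..y. chi4_divisor_sum n / real n) \<le> (\<Prod>p\<in>?P. ?F p)"
    using fin by (intro smooth_sum_le_euler_product) (auto simp: in_prime_factors_iff dest!: dvd_imp_le)
  then have "2 / 3 * harm y \<le> 2 * (1 / E1\<^sup>2) * (1 / E3)"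
    using sum_chi4_divisor_sum_over_n_bounds(1)[of y] prod by linarith
  also have "\<dots> \<le> 2 * (1 / E1\<^sup>2) * (1 / (1 / 2))"
    using E1 E3 by (intro mult_left_mono divide_left_mono) auto
  finally have "harm y \<le> 6 / E1\<^sup>2" by simp
  moreover have "ln (real y) \<le> harm y"
  proof -
    have "ln (real y) \<le> ln (real y + 1)" using assms by simp
    then show ?thesis using ln_le_harm[of y] by linarith
  qed
  ultimately have "ln (real y) \<le> 6 / E1\<^sup>2" by linarith
  then have "ln (real y) * E1\<^sup>2 \<le> 6" using E1 by (simp add: pos_le_divide_eq)
  moreover have "ln (real y) > 0" using assms by simp
  ultimately show ?thesis unfolding E1_def[symmetric] by (simp add: pos_le_divide_eq mult.commute)
qed

lemma chi4_divisor_sum_prod_primes_1mod4: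
  assumes "m \<subseteq> primes_1mod4 y"
  shows "chi4_divisor_sum (\<Prod>m) = 2 ^ card m"
  using finite_subset[OF assms finite_primes_1mod4] assms
proof (induction m rule: finite_induct)
  case empty
  show ?case by (simp add: chi4_divisor_sum_def chi4_1)
next
  case (insert p m)
  have p: "prime p" "chi4 p = 1" using insert.prems primes_1mod4D by auto
  have "\<not> p dvd \<Prod>m"
  proof
    assume "p dvd \<Prod>m"
    then obtain q where "q \<in> m" "p dvd q"
      using prime_dvd_prod_iff[OF insert.hyps(1) p(1), of "\<lambda>x. x"] by auto
    then have "p = q" using p(1) insert.prems primes_dvd_imp_eq primes_1mod4D(1) by blast
    then show False using \<open>q \<in> m\<close> insert.hyps by simp
  qed
  from chi4_divisor_sum_prime_power_mult[OF p(1) this, of 1]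
  show ?case using insert p by (simp add: chi4_1)
qed

lemma primes_1mod4_coprime: "pairwise coprime (primes_1mod4 y)"
  by (auto simp: pairwise_def primes_1mod4_def intro: primes_coprime)

text \<open>Expanding the product gives \<open>chi4_divisor_sum n / n\<close> summed over squarefree
  \<open>n\<close> built from these primes, many far larger than \<open>y\<close>. The logarithmic
  weight retains at least half of the total while confining \<open>n\<close> to
  \<open>n \<le> y ^ 8\<close>, where the sum is at most \<open>harm (y ^ 8)\<close>.\<close>

lemma prod_one_plus_primes_1mod4_le:
  assumes "y \<ge> 2"
  shows "(\<Prod>p\<in>primes_1mod4 y. 1 + 2 / real p) \<le> 2 + 16 * ln (real y)"
proof -
  let ?P = "primes_1mod4 y"
  \<comment> \<open>The exponent is what \<open>log_weight_average\<close> asks for: the sum of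
    \<open>ln p / p\<close> is at most \<open>2 * ln y\<close>, the choice
    \<open>h p = 2 / p\<close> doubles it, and the hypothesis doubles it again.\<close>
  define D where "D = real y ^ 8"
  have D: "D > 1" using assms by (simp add: D_def)
  have lnD: "ln D = 8 * ln (real y)" using assms by (simp add: D_def ln_realpow)
  note fin = finite_primes_1mod4[of y]
  have "(\<Sum>p\<in>?P. (2 / real p) / (1 + 2 / real p) * ln (real p)) \<le> (\<Sum>p\<in>?P. 2 * (ln (real p) / real p))"
  proof (rule sum_mono)
    fix p assume "p \<in> ?P"
    then have "real p \<ge> 5" using primes_1mod4D(3) by force
    have frac: "x / (1 + x) \<le> x" if "x \<ge> 0" for x :: real
      using that divide_left_mono[of 1 "1 + x" x] by simp
    have "(2 / real p) / (1 + 2 / real p) \<le> 2 / real p" by (rule frac) simp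
    moreover have "ln (real p) \<ge> 0" using \<open>real p \<ge> 5\<close> by simp
    ultimately have "(2 / real p) / (1 + 2 / real p) * ln (real p) \<le> 2 / real p * ln (real p)"
      by (rule mult_right_mono)
    then show "(2 / real p) / (1 + 2 / real p) * ln (real p) \<le> 2 * (ln (real p) / real p)" by simp
  qed
  also have "\<dots> = 2 * (\<Sum>p\<in>?P. ln (real p) / real p)" by (simp add: sum_distrib_left)
  also have "(\<Sum>p\<in>?P. ln (real p) / real p) \<le> (\<Sum>p | prime p \<and> p \<le> y. ln (real p) / real p)"
    by (intro sum_mono2) (auto simp: primes_1mod4_def dest: prime_gt_0_nat)
  also have "\<dots> \<le> 2 * ln (real y)" using assms by (intro sum_ln_over_primes_le) simp
  finally have "2 * (\<Sum>p\<in>?P. (2 / real p) / (1 + 2 / real p) * ln (real p)) \<le> ln D"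
    using lnD by simp
  then have "(\<Prod>p\<in>?P. 1 + 2 / real p) / 2 \<le> (\<Sum>m\<in>Pow ?P. (\<Prod>p\<in>m. 2 / real p) * log_weight D m)"
    using fin D by (intro log_weight_average) (auto dest: primes_1mod4D(3))
  also have "\<dots> \<le> (\<Sum>m\<in>{m \<in> Pow ?P. \<Prod>m \<le> y ^ 8}. chi4_divisor_sum (\<Prod>m) / real (\<Prod>m))"
  proof -
    let ?Q = "{m \<in> Pow ?P. \<Prod>m \<le> y ^ 8}"
    have "(\<Sum>m\<in>Pow ?P. (\<Prod>p\<in>m. 2 / real p) * log_weight D m) = (\<Sum>m\<in>?Q. (\<Prod>p\<in>m. 2 / real p) * log_weight D m)"
    proof (rule sum.mono_neutral_right)
      show "\<forall>m\<in>Pow ?P - ?Q. (\<Prod>p\<in>m. 2 / real p) * log_weight D m = 0"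
      proof
        fix m assume "m \<in> Pow ?P - ?Q"
        then have "\<not> real (\<Prod>m) \<le> real (y ^ 8)" by (simp only: of_nat_le_iff) simp
        then have "log_weight D m = 0" using log_weight_nonzero[OF D, of m] by (auto simp: D_def)
        then show "(\<Prod>p\<in>m. 2 / real p) * log_weight D m = 0" by simp
      qed
    qed (use fin in auto)
    also have "\<dots> \<le> (\<Sum>m\<in>?Q. (\<Prod>p\<in>m. 2 / real p) * 1)"
      using log_weight_bounds[OF D] by (intro sum_mono mult_left_mono) (auto intro: prod_nonneg)
    also have "\<dots> = (\<Sum>m\<in>?Q. chi4_divisor_sum (\<Prod>m) / real (\<Prod>m))"
      by (intro sum.cong refl) (auto simp: chi4_divisor_sum_prod_primes_1mod4 prod_dividef)
    finally show ?thesis .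
  qed
  also have "\<dots> = (\<Sum>n\<in>Prod ` {m \<in> Pow ?P. \<Prod>m \<le> y ^ 8}. chi4_divisor_sum n / real n)"
  proof -
    have "inj_on Prod (Pow ?P)"
      using fin primes_1mod4_coprime by (intro inj_on_Prod_Pow) (auto dest: primes_1mod4D(3))
    then have "inj_on Prod {m \<in> Pow ?P. \<Prod>m \<le> y ^ 8}" by (rule inj_on_subset) auto
    then show ?thesis by (subst sum.reindex) auto
  qed
  also have "\<dots> \<le> (\<Sum>n=1..y ^ 8. chi4_divisor_sum n / real n)"
  proof (rule sum_mono2)
    show "Prod ` {m \<in> Pow ?P. \<Prod>m \<le> y ^ 8} \<subseteq> {1..y ^ 8}"
    proof (rule image_subsetI)
      fix m assume m: "m \<in> {m \<in> Pow ?P. \<Prod>m \<le> y ^ 8}"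
      then have "\<Prod>m > 0" by (intro prod_pos) (force dest: primes_1mod4D(3))
      then show "\<Prod>m \<in> {1..y ^ 8}" using m by simp
    qed
  qed (auto intro!: divide_nonneg_nonneg chi4_divisor_sum_nonneg)
  also have "\<dots> \<le> harm (y ^ 8)" by (rule sum_chi4_divisor_sum_over_n_bounds)
  also have "\<dots> \<le> 1 + ln (real (y ^ 8))"
    using euler_mascheroni_sequence_decreasing[of 1 "y ^ 8"] assms by (simp add: harm_expand)
  also have "ln (real (y ^ 8)) = 8 * ln (real y)" using lnD by (simp add: D_def)
  finally show ?thesis by simp
qed

text \<open>With \<open>t = 1 / p\<close>, \<open>(1 - t - t\<^sup>2)\<^sup>2 * (1 + 2 * t) \<ge> 1
  - 5 * t\<^sup>2\<close>, and the product of the right sides is at least 1 - 5/12. An upper bound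
  for the product of \<open>1 + 2 / p\<close> thus becomes a lower bound for the density of the
  lower sieve.\<close>

lemma prod_primes_1mod4_lower:
  assumes "y \<ge> 2"
  shows "1 / (4 + 32 * ln (real y)) \<le> (\<Prod>p\<in>primes_1mod4 y. 1 - 1 / real p - 1 / (real p)\<^sup>2)\<^sup>2"
proof -
  let ?P = "primes_1mod4 y"
  note fin = finite_primes_1mod4[of y]
  define U where "U = (\<Prod>p\<in>?P. 1 + 2 / real p)"
  define V where "V = (\<Prod>p\<in>?P. 1 - 1 / real p - 1 / (real p)\<^sup>2)"
  have p5: "real p \<ge> 5" if "p \<in> ?P" for p using primes_1mod4D(3)[OF that] by simp
  have "1 - 1 / (4 * (real 5 - 2)) * 5 \<le> 1 - (\<Sum>p\<in>?P. 5 * (1 / (real p)\<^sup>2))"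
  proof -
    have "(\<Sum>p\<in>?P. 1 / (real p)\<^sup>2) \<le> 1 / (4 * (real 5 - 2))"
      using fin by (intro sum_inverse_square_residue_le) (auto dest: primes_1mod4D)
    moreover have "(\<Sum>p\<in>?P. 5 * (1 / (real p)\<^sup>2)) = 5 * (\<Sum>p\<in>?P. 1 / (real p)\<^sup>2)"
      by (simp only: sum_distrib_left)
    ultimately show ?thesis by linarith
  qed
  also have "\<dots> \<le> (\<Prod>p\<in>?P. 1 - 5 * (1 / (real p)\<^sup>2))"
  proof (rule Weierstrass_prod_ineq)
    fix p assume "p \<in> ?P"
    then have "5 * 5 \<le> real p * real p" using p5 by (intro mult_mono) auto
    then show "5 * (1 / (real p)\<^sup>2) \<in> {0..1}" by (simp add: power2_eq_square divide_le_eq)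
  qed
  also have "\<dots> \<le> (\<Prod>p\<in>?P. (1 - 1 / real p - 1 / (real p)\<^sup>2)\<^sup>2 * (1 + 2 / real p))"
  proof (rule prod_mono)
    fix p assume p: "p \<in> ?P"
    define t where "t = 1 / real p"
    have t: "0 \<le> t" "t \<le> 1 / 5" using p5[OF p] by (auto simp: t_def field_simps)
    have "5 * 5 \<le> real p * real p" using p5[OF p] by (intro mult_mono) auto
    then have "0 \<le> 1 - 5 * t\<^sup>2" using p5[OF p] by (simp add: t_def power2_eq_square field_simps)
    moreover have "(1 - t - t\<^sup>2)\<^sup>2 * (1 + 2 * t) = 1 - 5 * t\<^sup>2 + (5 * t ^ 4 + 2 * t ^ 5)"
      by (simp add: algebra_simps eval_nat_numeral)
    moreover have "0 \<le> 5 * t ^ 4 + 2 * t ^ 5" using t by simp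
    ultimately show "0 \<le> 1 - 5 * (1 / (real p)\<^sup>2) \<and>
        1 - 5 * (1 / (real p)\<^sup>2) \<le> (1 - 1 / real p - 1 / (real p)\<^sup>2)\<^sup>2 * (1 + 2 / real p)"
      by (simp add: t_def power_one_over)
  qed
  also have "\<dots> = V\<^sup>2 * U" by (simp add: V_def U_def prod.distrib prod_power_distrib)
  finally have "1 / 2 \<le> V\<^sup>2 * U" by simp
  also have "\<dots> \<le> V\<^sup>2 * (2 + 16 * ln (real y))"
    unfolding U_def using assms by (intro mult_left_mono prod_one_plus_primes_1mod4_le) auto
  finally have "1 \<le> V\<^sup>2 * (4 + 32 * ln (real y))" by (simp add: algebra_simps)
  moreover have "4 + 32 * ln (real y) > 0" using assms by (intro add_pos_nonneg) auto
  ultimately show ?thesis unfolding V_def by (subst pos_divide_le_eq)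
qed

section \<open>Sieving the values of \<open>n\<^sup>2 + 1\<close>\<close>

lemma prime_dvd_square_plus_one_iff:
  assumes "prime p" "odd (p::nat)"
  shows "(\<exists>m. p dvd m\<^sup>2 + 1) \<longleftrightarrow> p mod 4 = 1"
proof -
  have p2: "p > 2" using assms prime_ge_2_nat[of p] by (cases "p = 2") auto
  have QR: "QuadRes (int p) (- 1) \<longleftrightarrow> (\<exists>m. p dvd m\<^sup>2 + 1)"
  proof
    assume "QuadRes (int p) (- 1)"
    then obtain z where "[z\<^sup>2 = - 1] (mod int p)" by (auto simp: QuadRes_def)
    then have "int p dvd z\<^sup>2 + 1" by (simp add: cong_iff_dvd_diff)
    then have "int p dvd int ((nat \<bar>z\<bar>)\<^sup>2 + 1)" by (simp add: add.commute)
    then show "\<exists>m. p dvd m\<^sup>2 + 1" by (metis int_dvd_int_iff)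
  next
    assume "\<exists>m. p dvd m\<^sup>2 + 1"
    then obtain m where "p dvd m\<^sup>2 + 1" by blast
    then have "int p dvd int (m\<^sup>2 + 1)" by (simp only: int_dvd_int_iff)
    then have "[(int m)\<^sup>2 = - 1] (mod int p)" by (simp add: cong_iff_dvd_diff add.commute)
    then show "QuadRes (int p) (- 1)" by (auto simp: QuadRes_def)
  qed
  have euler: "[Legendre (- 1) (int p) = (- 1) ^ ((p - 1) div 2)] (mod int p)"
    by (rule euler_criterion) (use assms p2 in auto)
  have not0: "\<not> [- 1 = 0] (mod int p)" using p2 by (simp add: cong_iff_dvd_diff)
  have not2: "\<not> [1 = - 1] (mod int p)" "\<not> [- 1 = 1] (mod int p)"
  proof -
    have "\<not> int p dvd 2" using p2 by (auto dest: zdvd_imp_le)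
    moreover have "\<not> int p dvd - 2" using \<open>\<not> int p dvd 2\<close> by simp
    ultimately show "\<not> [1 = - 1] (mod int p)" "\<not> [- 1 = 1] (mod int p)" by (simp_all add: cong_iff_dvd_diff)
  qed
  have leg: "Legendre (- 1) (int p) = (if QuadRes (int p) (- 1) then 1 else - 1)"
    using not0 by (simp add: Legendre_def)
  have "p mod 4 = 1 \<or> p mod 4 = 3" using assms(2) by presburger
  then show ?thesis
  proof
    assume m: "p mod 4 = 1"
    then have "even ((p - 1) div 2)" by presburger
    then have "[Legendre (- 1) (int p) = 1] (mod int p)" using euler by simp
    then show ?thesis using leg not2 QR m by (auto split: if_splits)
  next
    assume m: "p mod 4 = 3"
    then have "odd ((p - 1) div 2)" by presburger
    then have "[Legendre (- 1) (int p) = - 1] (mod int p)" using euler by simp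
    then show ?thesis using leg not2 QR m by (auto split: if_splits)
  qed
qed

text \<open>\<open>p ^ k\<close> divides \<open>(a - b) * (a + b)\<close>. An odd \<open>p\<close>
  dividing both factors would divide \<open>a\<close>, against \<open>p dvd a\<^sup>2 + 1\<close>;
  so one factor is coprime to \<open>p\<close> and the other absorbs the whole power.\<close>

lemma square_roots_minus_one:
  fixes a b :: nat
  assumes p: "prime p" "odd p" and dvd: "p ^ k dvd a\<^sup>2 + 1" "p ^ k dvd b\<^sup>2 + 1" and "k > 0"
  shows "[a = b] (mod p ^ k) \<or> p ^ k dvd a + b"
proof -
  have "int (p ^ k) dvd int (a\<^sup>2 + 1) - int (b\<^sup>2 + 1)"
    using dvd by (intro dvd_diff) (simp_all only: int_dvd_int_iff)
  also have "int (a\<^sup>2 + 1) - int (b\<^sup>2 + 1) = (int a - int b) * (int a + int b)"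
    by (simp add: algebra_simps power2_eq_square)
  finally have d: "int p ^ k dvd (int a - int b) * (int a + int b)" by simp
  have pa: "\<not> int p dvd int a"
  proof
    assume "int p dvd int a"
    then have "p dvd a\<^sup>2" by (simp add: power2_eq_square)
    moreover have "p dvd a\<^sup>2 + 1" using dvd(1) \<open>k > 0\<close> dvd_power[of k p] dvd_trans by blast
    ultimately have "p dvd 1" by (simp only: dvd_add_right_iff)
    then show False using p(1) not_prime_unit by blast
  qed
  have ip: "prime (int p)" using p(1) by simp
  have "\<not> (int p dvd int a - int b \<and> int p dvd int a + int b)"
  proof
    assume "int p dvd int a - int b \<and> int p dvd int a + int b"
    then have "int p dvd (int a - int b) + (int a + int b)" by (blast intro: dvd_add)
    then have "int p dvd 2 * int a" by simp
    then have "int p dvd 2 \<or> int p dvd int a" using ip prime_dvd_mult_iff by blast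
    moreover have "\<not> p dvd 2" using p by (metis dvd_refl primes_dvd_imp_eq two_is_prime_nat)
    then have "\<not> int p dvd 2" by (metis int_dvd_int_iff of_nat_numeral)
    ultimately show False using pa by blast
  qed
  then have "coprime (int p ^ k) (int a - int b) \<or> coprime (int p ^ k) (int a + int b)"
    using ip prime_imp_coprime by (metis coprime_power_left_iff)
  then show ?thesis
  proof
    assume "coprime (int p ^ k) (int a - int b)"
    then have "int p ^ k dvd int a + int b" using d by (simp add: coprime_dvd_mult_right_iff)
    then have "int (p ^ k) dvd int (a + b)" by simp
    then show ?thesis by (simp only: int_dvd_int_iff) simp
  next
    assume "coprime (int p ^ k) (int a + int b)"
    then have "int p ^ k dvd int a - int b" using d by (simp add: coprime_dvd_mult_left_iff)
    then have "[int a = int b] (mod int (p ^ k))" by (simp add: cong_iff_dvd_diff)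
    then show ?thesis by (simp only: cong_int_iff) simp
  qed
qed

text \<open>Any root other than \<open>a\<close> is, after the shift by 1, the negative of
  \<open>a\<close> modulo \<open>p ^ k\<close>, so two such roots coincide.\<close>

lemma card_roots_le_two:
  assumes p: "prime p" "odd (p::nat)" "k > 0"
  shows "card {n. n < p ^ k \<and> p ^ k dvd (n + 1)\<^sup>2 + 1} \<le> 2" (is "card ?R \<le> 2")
proof (cases "?R = {}")
  case False
  then obtain a where a: "a \<in> ?R" by blast
  have fin: "finite ?R" by (rule finite_subset[of _ "{..<p ^ k}"]) auto
  have "card (?R - {a}) \<le> Suc 0"
  proof (subst card_le_Suc0_iff_eq)
    show "\<forall>b\<in>?R - {a}. \<forall>c\<in>?R - {a}. b = c"
    proof (intro ballI)
      fix b c assume b: "b \<in> ?R - {a}" and c: "c \<in> ?R - {a}"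
      have *: "p ^ k dvd (a + 1) + (d + 1)" if "d \<in> ?R - {a}" for d
      proof -
        have "\<not> [a + 1 = d + 1] (mod p ^ k)"
          using that a by (auto simp: unique_euclidean_semiring_class.cong_def dest: cong_less_modulus_unique_nat)
            (metis cong_add_rcancel_nat cong_less_modulus_unique_nat Suc_eq_plus1 unique_euclidean_semiring_class.cong_def)
        then show ?thesis using square_roots_minus_one[OF p(1,2), of k "a + 1" "d + 1"] that a p(3) by auto
      qed
      have "[(a + 1) + (b + 1) = (a + 1) + (c + 1)] (mod p ^ k)"
        using *[OF b] *[OF c] by (metis cong_0_iff cong_sym cong_trans)
      then have "[b = c] (mod p ^ k)" by (simp only: cong_add_lcancel_nat cong_add_rcancel_nat)
      then show "b = c" using b c by (intro cong_less_modulus_unique_nat) auto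
    qed
  qed (use fin in simp)
  then show ?thesis using a fin by (simp add: card_Diff_singleton)
qed (simp only: card.empty)

text \<open>The upper bound needs the exact density \<open>2 / p\<close>, as fewer roots would
  weaken the sieve. The roots come from a square root \<open>m\<close> of -1 and its negative; they
  differ because \<open>p\<close> is odd and does not divide \<open>m\<close>.\<close>

lemma card_roots_eq_two:
  assumes p: "prime p" "p mod 4 = (1::nat)"
  shows "card {n. n < p \<and> p dvd (n + 1)\<^sup>2 + 1} = 2" (is "card ?R = 2")
proof -
  have odd: "odd p" using p(2) by presburger
  have p0: "p > 0" using p(1) prime_gt_0_nat by blast
  obtain m where m: "p dvd m\<^sup>2 + 1" using prime_dvd_square_plus_one_iff[OF p(1) odd] p(2) by blast
  have root: "nat ((z - 1) mod int p) \<in> ?R" if "int p dvd z\<^sup>2 + 1" for z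
  proof -
    define n where "n = nat ((z - 1) mod int p)"
    have n: "int n = (z - 1) mod int p" using p0 by (simp add: n_def)
    have "[int n = z - 1] (mod int p)" by (simp add: n unique_euclidean_semiring_class.cong_def)
    then have "[int n + 1 = z - 1 + 1] (mod int p)" by (intro cong_add cong_refl)
    then have "[(int n + 1)\<^sup>2 + 1 = z\<^sup>2 + 1] (mod int p)" by (intro cong_add cong_pow cong_refl) simp
    then have "int p dvd (int n + 1)\<^sup>2 + 1" using that cong_dvd_iff by blast
    then have "int p dvd int ((n + 1)\<^sup>2 + 1)" by (simp add: add.commute)
    then have "p dvd (n + 1)\<^sup>2 + 1" by (simp only: int_dvd_int_iff)
    moreover have "n < p" using p0 by (simp add: n_def nat_less_iff)
    ultimately show ?thesis unfolding n_def by simp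
  qed
  have im: "int p dvd (int m)\<^sup>2 + 1" using m by (metis int_dvd_int_iff of_nat_1 of_nat_add of_nat_power)
  let ?a = "nat ((int m - 1) mod int p)" and ?b = "nat ((- int m - 1) mod int p)"
  have "?a \<noteq> ?b"
  proof
    assume "?a = ?b"
    then have "(int m - 1) mod int p = (- int m - 1) mod int p" using p0 by (simp add: nat_eq_iff2)
    then have "int p dvd (int m - 1) - (- int m - 1)" by (simp add: mod_eq_dvd_iff)
    then have "int p dvd int (2 * m)" by simp
    then have "p dvd 2 * m" by (simp only: int_dvd_int_iff)
    then have "p dvd 2 \<or> p dvd m" using p(1) prime_dvd_mult_iff by blast
    moreover have "\<not> p dvd 2" using p(1) odd by (metis dvd_refl primes_dvd_imp_eq two_is_prime_nat)
    ultimately have "p dvd m\<^sup>2" by (simp add: power2_eq_square)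
    then have "p dvd 1" using m by (simp only: dvd_add_right_iff)
    then show False using p(1) not_prime_unit by blast
  qed
  then have "card {?a, ?b} = 2" by simp
  moreover have "{?a, ?b} \<subseteq> ?R" using root[OF im] root[of "- int m"] im by auto
  ultimately have "2 \<le> card ?R" using card_mono[of ?R "{?a, ?b}"] by simp
  moreover have "card ?R \<le> 2" using card_roots_le_two[OF p(1) odd, of 1] by simp
  ultimately show ?thesis by simp
qed

text \<open>The shift by 1 lets \<open>n < N\<close> stand for the positive integers up to
  \<open>N\<close>.\<close>

definition root_at :: "nat \<Rightarrow> nat \<Rightarrow> bool" where
  "root_at q n \<longleftrightarrow> q dvd (n + 1)\<^sup>2 + 1"

lemma root_at_mod: "root_at q (n mod q) = root_at q n"
proof -
  have "[(n mod q + 1)\<^sup>2 + 1 = (n + 1)\<^sup>2 + 1] (mod q)"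
    by (intro cong_add cong_pow cong_refl) (simp add: unique_euclidean_semiring_class.cong_def)
  then show ?thesis unfolding root_at_def by (rule cong_dvd_iff)
qed

text \<open>Exponent 1 sifts out values divisible by \<open>p\<close>, exponent 2 only those
  divisible by \<open>p\<^sup>2\<close>. The upper bound takes \<open>Q = S\<close> with exponent 1;
  the lower bound takes all of \<open>primes_1mod4 y\<close>, with exponent 1 on \<open>S\<close>
  and 2 off it.\<close>

locale root_sieve =
  fixes y :: nat and Q :: "nat set" and e :: "nat \<Rightarrow> nat"
  assumes y: "y \<ge> 2" and Q: "Q \<subseteq> primes_1mod4 y" and e: "p \<in> Q \<Longrightarrow> e p = 1 \<or> e p = 2"
begin

lemma finQ: "finite Q" using Q finite_primes_1mod4 finite_subset by blast

lemma Q_facts: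
  assumes "p \<in> Q"
  shows "prime p" "odd p" "p \<ge> 5" "p \<le> y" "e p > 0" "p \<le> p ^ e p" "p ^ e p \<le> y ^ 2"
proof -
  have "p \<in> primes_1mod4 y" using assms Q by blast
  from primes_1mod4D[OF this] show p: "prime p" "p \<ge> 5" "p \<le> y" and "odd p" by (auto, presburger)
  show e0: "e p > 0" using e[OF assms] by auto
  have "p ^ 1 \<le> p ^ e p" using e0 p by (intro power_increasing) auto
  then show "p \<le> p ^ e p" by simp
  have "p ^ e p \<le> p ^ 2" using e[OF assms] p by (intro power_increasing) auto
  also have "\<dots> \<le> y ^ 2" using p by (intro power_mono) auto
  finally show "p ^ e p \<le> y ^ 2" .
qed

abbreviation "moduli \<equiv> (\<lambda>p. p ^ e p) ` Q"

lemma coprime_powers: "p \<in> Q \<Longrightarrow> p' \<in> Q \<Longrightarrow> p \<noteq> p' \<Longrightarrow> coprime (p ^ e p) (p' ^ e p')"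
  using primes_coprime[OF Q_facts(1) Q_facts(1), of p p'] by simp

lemma inj_powers: "inj_on (\<lambda>p. p ^ e p) Q"
proof (rule inj_onI, rule ccontr)
  fix p p' assume *: "p \<in> Q" "p' \<in> Q" "p ^ e p = p' ^ e p'" "p \<noteq> p'"
  then have "coprime (p ^ e p) (p ^ e p)" using coprime_powers[of p p'] by simp
  then have "p ^ e p = 1" by simp
  then show False using Q_facts(3,6)[OF *(1)] by linarith
qed

sublocale coprime_sieve moduli root_at
proof
  show "finite moduli" using finQ by simp
  show "q > 1" if "q \<in> moduli" for q using that Q_facts(3,6) by fastforce
  show "pairwise coprime moduli" 
  proof (rule pairwiseI)
    fix q q' assume "q \<in> moduli" "q' \<in> moduli" "q \<noteq> q'"
    then obtain p p' where "p \<in> Q" "p' \<in> Q" "q = p ^ e p" "q' = p' ^ e p'" "p \<noteq> p'" by blast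
    then show "coprime q q'" using coprime_powers by simp
  qed
  show "root_at q (n mod q) = root_at q n" if "q \<in> moduli" for q n by (rule root_at_mod)
  show "2 * card {n. n < q \<and> root_at q n} \<le> q" if mem: "q \<in> moduli" for q
  proof -
    obtain p where p: "p \<in> Q" "q = p ^ e p" using mem by blast
    then have "card {n. n < q \<and> root_at q n} \<le> 2" "5 \<le> q"
      using card_roots_le_two[OF Q_facts(1,2,5)[OF p(1)]] Q_facts(3,6)[OF p(1)] by (auto simp: root_at_def)
    then show ?thesis by linarith
  qed
qed

lemma g_le: "p \<in> Q \<Longrightarrow> g (p ^ e p) \<le> 2 / real (p ^ e p)"
  using card_roots_le_two[OF Q_facts(1,2,5)] unfolding g_def root_at_def
  by (intro divide_right_mono) (auto simp del: of_nat_power)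

text \<open>The source of uniformity: the bound is the same for all \<open>Q\<close> and
  \<open>e\<close>. A square modulus has density at most \<open>2 / p\<^sup>2\<close> and logarithm
  \<open>2 * ln p\<close>, so by \<open>2 / p \<le> 1\<close> its term also stays below
  \<open>2 * ln p / p\<close>.\<close>

lemma sum_g_ln: "(\<Sum>q\<in>moduli. g q * ln (real q)) \<le> 4 * ln (real y)"
proof -
  have "(\<Sum>q\<in>moduli. g q * ln (real q)) = (\<Sum>p\<in>Q. g (p ^ e p) * ln (real (p ^ e p)))"
    by (subst sum.reindex[OF inj_powers]) simp
  also have "\<dots> \<le> (\<Sum>p\<in>Q. 2 * (ln (real p) / real p))"
  proof (rule sum_mono)
    fix p assume p: "p \<in> Q"
    have p5: "real p \<ge> 5" using Q_facts(3)[OF p] by simp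
    have ln0: "ln (real p) \<ge> 0" using p5 by simp
    have "g (p ^ e p) * ln (real (p ^ e p)) \<le> 2 / real (p ^ e p) * ln (real (p ^ e p))"
      using g_le[OF p] p5 by (intro mult_right_mono) (auto simp: ln_realpow)
    also have "\<dots> \<le> 2 * (ln (real p) / real p)"
    proof (cases "e p = 1")
      case False
      then have "e p = 2" using e[OF p] by simp
      then have "ln (real (p ^ e p)) = 2 * ln (real p)" "real (p ^ e p) = real p * real p"
        using p5 by (simp_all add: ln_realpow) (simp add: power2_eq_square)
      then have "2 / real (p ^ e p) * ln (real (p ^ e p)) = 2 / real p * (2 * (ln (real p) / real p))"
        by simp
      also have "\<dots> \<le> 1 * (2 * (ln (real p) / real p))"
        using p5 ln0 by (intro mult_right_mono) auto
      finally show ?thesis by simp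
    qed simp
    finally show "g (p ^ e p) * ln (real (p ^ e p)) \<le> 2 * (ln (real p) / real p)" .
  qed
  also have "\<dots> = 2 * (\<Sum>p\<in>Q. ln (real p) / real p)" by (simp only: sum_distrib_left)
  also have "(\<Sum>p\<in>Q. ln (real p) / real p) \<le> (\<Sum>p | prime p \<and> p \<le> y. ln (real p) / real p)"
    using Q_facts(1,4) by (intro sum_mono2) (auto dest: prime_gt_0_nat)
  also have "\<dots> \<le> 2 * ln (real y)" using y by (intro sum_ln_over_primes_le) simp
  finally show ?thesis by simp
qed

lemma moduli_le: "q \<in> moduli \<Longrightarrow> real q \<le> real y ^ 2"
  using Q_facts(7) by (auto simp flip: of_nat_power)

lemma sum_g_ln_sq: "(\<Sum>q\<in>moduli. g q * (ln (real q))\<^sup>2) \<le> 8 * (ln (real y))\<^sup>2"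
proof -
  have lny: "ln (real y) \<ge> 0" using y by simp
  have "(\<Sum>q\<in>moduli. g q * (ln (real q))\<^sup>2) \<le> (\<Sum>q\<in>moduli. 2 * ln (real y) * (g q * ln (real q)))"
  proof (rule sum_mono)
    fix q assume q: "q \<in> moduli"
    have "ln (real q) \<le> ln (real y ^ 2)"
      using moduli_le[OF q] gt1[OF q] y by (subst ln_le_cancel_iff) auto
    also have "\<dots> = 2 * ln (real y)" using y by (simp add: ln_realpow)
    finally have "ln (real q) * (g q * ln (real q)) \<le> 2 * ln (real y) * (g q * ln (real q))"
      using g_bounds[OF q] gt1[OF q] by (intro mult_right_mono) auto
    then show "g q * (ln (real q))\<^sup>2 \<le> 2 * ln (real y) * (g q * ln (real q))"
      by (simp add: power2_eq_square mult_ac)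
  qed
  also have "\<dots> = 2 * ln (real y) * (\<Sum>q\<in>moduli. g q * ln (real q))" by (simp only: sum_distrib_left)
  also have "\<dots> \<le> 2 * ln (real y) * (4 * ln (real y))"
    using sum_g_ln lny by (intro mult_left_mono) auto
  finally show ?thesis by (simp add: power2_eq_square)
qed

definition survivors :: "nat \<Rightarrow> real" where
  "survivors N = (\<Sum>n<N. of_bool (\<forall>p\<in>Q. \<not> root_at (p ^ e p) n))"

lemma survivors_eq: "survivors N = real (sifted N)"
  by (simp add: sifted_eq survivors_def)

text \<open>The level \<open>D = y ^ 8\<close> just meets both hypotheses of the sieve:
  \<open>2 * (4 * ln y) = ln D\<close> and \<open>8 * (8 * (ln y)\<^sup>2) = (ln D)\<^sup>2\<close>.
  The errors in \<open>D ^ 4\<close> and \<open>D ^ 6\<close> become \<open>y ^ 32\<close> and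
  \<open>y ^ 48\<close>.\<close>

lemma sieve_level: "real y ^ 8 > 1" "ln (real y ^ 8) = 8 * ln (real y)"
  using y by (auto simp: ln_realpow)

lemma survivors_upper: "survivors N \<le> 4 * real N * (\<Prod>p\<in>Q. 1 - g (p ^ e p)) + 8 * real y ^ 32"
proof -
  have "(\<Prod>q\<in>moduli. 1 - g q) = (\<Prod>p\<in>Q. 1 - g (p ^ e p))"
    by (subst prod.reindex[OF inj_powers]) simp
  moreover have "2 * (\<Sum>q\<in>moduli. g q * ln (real q)) \<le> ln (real y ^ 8)"
    using sum_g_ln by (simp add: sieve_level)
  ultimately show ?thesis
    using sifted_upper[OF sieve_level(1), of N] by (simp add: survivors_eq flip: power_mult)
qed

lemma survivors_lower:
  "real N / 8 * (\<Prod>p\<in>Q. 1 - 2 / real (p ^ e p)) - 4 * real y ^ 48 \<le> survivors N"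
proof -
  have "(\<Prod>p\<in>Q. 1 - 2 / real (p ^ e p)) \<le> (\<Prod>p\<in>Q. 1 - g (p ^ e p))"
  proof (rule prod_mono)
    fix p assume p: "p \<in> Q"
    have "real (p ^ e p) \<ge> 5" using Q_facts(3,6)[OF p] by (simp del: of_nat_power)
    then have "2 / real (p ^ e p) \<le> 1" by (simp add: divide_le_eq del: of_nat_power)
    then show "0 \<le> 1 - 2 / real (p ^ e p) \<and> 1 - 2 / real (p ^ e p) \<le> 1 - g (p ^ e p)"
      using g_le[OF p] by linarith
  qed
  also have "\<dots> = (\<Prod>q\<in>moduli. 1 - g q)"
    by (subst prod.reindex[OF inj_powers]) simp
  finally have prods: "real N / 8 * (\<Prod>p\<in>Q. 1 - 2 / real (p ^ e p)) \<le> real N / 8 * (\<Prod>q\<in>moduli. 1 - g q)"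
    by (intro mult_left_mono) auto
  have "real N / 8 * (\<Prod>q\<in>moduli. 1 - g q) - 4 * (real y ^ 8) ^ 6 \<le> real (sifted N)"
  proof (rule sifted_lower[OF sieve_level(1)])
    show "2 * (\<Sum>q\<in>moduli. g q * ln (real q)) \<le> ln (real y ^ 8)"
      using sum_g_ln by (simp add: sieve_level)
    show "8 * (\<Sum>q\<in>moduli. g q * (ln (real q))\<^sup>2) \<le> (ln (real y ^ 8))\<^sup>2"
      using sum_g_ln_sq by (simp add: sieve_level power_mult_distrib)
    show "real q \<le> real y ^ 8" if "q \<in> moduli" for q
    proof -
      have "real y ^ 2 \<le> real y ^ 8" using y by (intro power_increasing) auto
      then show ?thesis using moduli_le[OF that] by linarith
    qed
  qed
  then show ?thesis using prods by (simp add: survivors_eq flip: power_mult)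
qed

end

section \<open>Averaging the sieve over sets of primes\<close>

definition small_primes_of :: "nat \<Rightarrow> nat \<Rightarrow> nat set" where
  "small_primes_of y n = {p \<in> primes_1mod4 y. root_at p n}"

lemma card_Pow_disjoint:
  assumes "finite P" "A \<subseteq> P"
  shows "(\<Sum>S\<in>Pow P. of_bool (S \<inter> A = {}) :: real) = 2 ^ card P / 2 ^ card A"
proof -
  have "Pow P \<inter> {S. S \<inter> A = {}} = Pow (P - A)" by auto
  then have "(\<Sum>S\<in>Pow P. of_bool (S \<inter> A = {}) :: real) = real (card (Pow (P - A)))"
    using assms(1) by (simp add: of_bool_def sum.If_cases)
  also have "\<dots> = 2 ^ (card P - card A)"
    using assms card_Diff_subset[OF finite_subset[OF assms(2,1)] assms(2)] by (simp add: card_Pow)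
  also have "\<dots> = 2 ^ card P / 2 ^ card A"
    using assms by (simp add: power_diff card_mono)
  finally show ?thesis .
qed

text \<open>After exchanging sums, each \<open>S\<close> contributes a sifted count. The sum of its
  densities over \<open>S\<close> factors into \<open>1 + (1 - 2 / p) = 2 * (1 - 1 / p)\<close>, and
  the powers of 2 cancel the number of subsets.\<close>

lemma weighted_count_upper:
  assumes y: "y \<ge> 2"
  shows "(\<Sum>n<N. 1 / 2 ^ card (small_primes_of y n)) \<le>
    4 * real N * (\<Prod>p\<in>primes_1mod4 y. 1 - 1 / real p) + 8 * real y ^ 32"
proof -
  let ?P = "primes_1mod4 y"
  note fin = finite_primes_1mod4[of y]
  let ?c = "2 ^ card ?P :: real"
  have "?c * (\<Sum>n<N. 1 / 2 ^ card (small_primes_of y n)) =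
      (\<Sum>n<N. \<Sum>S\<in>Pow ?P. of_bool (\<forall>p\<in>S. \<not> root_at p n))"
    unfolding sum_distrib_left
  proof (rule sum.cong[OF refl])
    fix n
    have "(\<Sum>S\<in>Pow ?P. of_bool (\<forall>p\<in>S. \<not> root_at p n) :: real) = (\<Sum>S\<in>Pow ?P. of_bool (S \<inter> small_primes_of y n = {}))"
      by (intro sum.cong refl arg_cong[of _ _ of_bool]) (auto simp: small_primes_of_def)
    also have "\<dots> = ?c / 2 ^ card (small_primes_of y n)"
      using fin by (intro card_Pow_disjoint) (auto simp: small_primes_of_def)
    finally show "?c * (1 / 2 ^ card (small_primes_of y n)) = (\<Sum>S\<in>Pow ?P. of_bool (\<forall>p\<in>S. \<not> root_at p n))"
      by simp
  qed
  also have "\<dots> = (\<Sum>S\<in>Pow ?P. \<Sum>n<N. of_bool (\<forall>p\<in>S. \<not> root_at p n))"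
    by (rule sum.swap)
  also have "\<dots> \<le> (\<Sum>S\<in>Pow ?P. 4 * real N * (\<Prod>p\<in>S. 1 - 2 / real p) + 8 * real y ^ 32)"
  proof (rule sum_mono)
    fix S assume S: "S \<in> Pow ?P"
    interpret root_sieve y S "\<lambda>_. 1" by unfold_locales (use y S in auto)
    have "g p = 2 / real p" if "p \<in> S" for p
      using card_roots_eq_two[of p] primes_1mod4D[of p y] that S by (auto simp: g_def root_at_def)
    then have "(\<Prod>p\<in>S. 1 - g p) = (\<Prod>p\<in>S. 1 - 2 / real p)" by (intro prod.cong) auto
    then show "(\<Sum>n<N. of_bool (\<forall>p\<in>S. \<not> root_at p n)) \<le> 4 * real N * (\<Prod>p\<in>S. 1 - 2 / real p) + 8 * real y ^ 32"
      using survivors_upper[of N, unfolded survivors_def] by (simp only: power_one_right)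
  qed
  also have "\<dots> = 4 * real N * (\<Prod>p\<in>?P. 1 + (1 - 2 / real p)) + ?c * (8 * real y ^ 32)"
    unfolding sum.distrib sum_distrib_left[symmetric] sum_Pow_prod[OF fin] sum_constant card_Pow[OF fin]
    by simp
  also have "(\<Prod>p\<in>?P. 1 + (1 - 2 / real p)) = (\<Prod>p\<in>?P. 2 * (1 - 1 / real p))"
    by (intro prod.cong) auto
  also have "\<dots> = ?c * (\<Prod>p\<in>?P. 1 - 1 / real p)" by (simp only: prod.distrib prod_constant)
  also have "4 * real N * (?c * (\<Prod>p\<in>?P. 1 - 1 / real p)) + ?c * (8 * real y ^ 32) =
      ?c * (4 * real N * (\<Prod>p\<in>?P. 1 - 1 / real p) + 8 * real y ^ 32)"
    by (simp add: distrib_left)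
  finally show ?thesis by (rule mult_left_le_imp_le) simp
qed

text \<open>Surviving with exponents \<open>e S\<close> forces that no \<open>p\<^sup>2\<close>
  divides the value and that \<open>S\<close> contains none of its prime divisors. Summed over
  \<open>S\<close>, the densities factor into
  \<open>(1 - 2 / p) + (1 - 2 / p\<^sup>2)\<close>.\<close>

lemma weighted_count_lower:
  assumes y: "y \<ge> 2"
  shows "real N / 8 * (\<Prod>p\<in>primes_1mod4 y. 1 - 1 / real p - 1 / (real p)\<^sup>2) - 4 * real y ^ 48 \<le>
    (\<Sum>n<N. of_bool (\<forall>p\<in>primes_1mod4 y. \<not> root_at (p\<^sup>2) n) / 2 ^ card (small_primes_of y n))"
proof -
  let ?P = "primes_1mod4 y"
  note fin = finite_primes_1mod4[of y]
  let ?c = "2 ^ card ?P :: real"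
  define e :: "nat set \<Rightarrow> nat \<Rightarrow> nat" where "e S p = (if p \<in> S then 1 else 2)" for S p
  let ?w = "\<lambda>n. of_bool (\<forall>p\<in>?P. \<not> root_at (p\<^sup>2) n) / 2 ^ card (small_primes_of y n) :: real"
  have "(\<Prod>p\<in>?P. (1 - 2 / real p) + (1 - 2 / (real p)\<^sup>2)) =
      (\<Sum>S\<in>Pow ?P. (\<Prod>p\<in>S. 1 - 2 / real p) * (\<Prod>p\<in>?P - S. 1 - 2 / (real p)\<^sup>2))"
    by (rule prod_add[OF fin])
  also have "\<dots> = (\<Sum>S\<in>Pow ?P. \<Prod>p\<in>?P. 1 - 2 / real (p ^ e S p))"
  proof (rule sum.cong[OF refl])
    fix S assume "S \<in> Pow ?P"
    then have "S \<subseteq> ?P" by simp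
    have e: "(\<Prod>p\<in>?P - S. 1 - 2 / real (p ^ e S p)) = (\<Prod>p\<in>?P - S. 1 - 2 / (real p)\<^sup>2)"
      "(\<Prod>p\<in>S. 1 - 2 / real (p ^ e S p)) = (\<Prod>p\<in>S. 1 - 2 / real p)"
      by (rule prod.cong, simp, simp add: e_def)+
    show "(\<Prod>p\<in>S. 1 - 2 / real p) * (\<Prod>p\<in>?P - S. 1 - 2 / (real p)\<^sup>2) = (\<Prod>p\<in>?P. 1 - 2 / real (p ^ e S p))"
      unfolding prod.subset_diff[OF \<open>S \<subseteq> ?P\<close> fin] e by (rule mult.commute)
  qed
  finally have split: "(\<Prod>p\<in>?P. (1 - 2 / real p) + (1 - 2 / (real p)\<^sup>2)) =
    (\<Sum>S\<in>Pow ?P. \<Prod>p\<in>?P. 1 - 2 / real (p ^ e S p))" .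
  have "(\<Prod>p\<in>?P. (1 - 2 / real p) + (1 - 2 / (real p)\<^sup>2)) = (\<Prod>p\<in>?P. 2 * (1 - 1 / real p - 1 / (real p)\<^sup>2))"
    by (intro prod.cong) auto
  also have "\<dots> = ?c * (\<Prod>p\<in>?P. 1 - 1 / real p - 1 / (real p)\<^sup>2)"
    by (simp only: prod.distrib prod_constant)
  finally have avg: "(\<Sum>S\<in>Pow ?P. \<Prod>p\<in>?P. 1 - 2 / real (p ^ e S p)) = ?c * (\<Prod>p\<in>?P. 1 - 1 / real p - 1 / (real p)\<^sup>2)"
    by (simp only: split)
  have "?c * (real N / 8 * (\<Prod>p\<in>?P. 1 - 1 / real p - 1 / (real p)\<^sup>2) - 4 * real y ^ 48) =
      real N / 8 * (\<Sum>S\<in>Pow ?P. \<Prod>p\<in>?P. 1 - 2 / real (p ^ e S p)) - ?c * (4 * real y ^ 48)"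
    unfolding avg by (simp only: right_diff_distrib mult.left_commute)
  also have "\<dots> = (\<Sum>S\<in>Pow ?P. real N / 8 * (\<Prod>p\<in>?P. 1 - 2 / real (p ^ e S p)) - 4 * real y ^ 48)"
    unfolding sum_subtractf sum_distrib_left[symmetric] sum_constant card_Pow[OF fin] by simp
  also have "\<dots> \<le> (\<Sum>S\<in>Pow ?P. \<Sum>n<N. of_bool (\<forall>p\<in>?P. \<not> root_at (p ^ e S p) n))"
  proof (rule sum_mono)
    fix S assume S: "S \<in> Pow ?P"
    interpret root_sieve y ?P "e S" by unfold_locales (use y in \<open>auto simp: e_def\<close>)
    show "real N / 8 * (\<Prod>p\<in>?P. 1 - 2 / real (p ^ e S p)) - 4 * real y ^ 48 \<le>
        (\<Sum>n<N. of_bool (\<forall>p\<in>?P. \<not> root_at (p ^ e S p) n))"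
      using survivors_lower[of N] by (simp only: survivors_def)
  qed
  also have "\<dots> = (\<Sum>n<N. \<Sum>S\<in>Pow ?P. of_bool (\<forall>p\<in>?P. \<not> root_at (p ^ e S p) n))"
    by (rule sum.swap)
  also have "\<dots> \<le> (\<Sum>n<N. ?c * ?w n)"
  proof (rule sum_mono)
    fix n
    let ?A = "small_primes_of y n"
    have "(\<Sum>S\<in>Pow ?P. of_bool (\<forall>p\<in>?P. \<not> root_at (p ^ e S p) n) :: real) \<le>
        (\<Sum>S\<in>Pow ?P. of_bool (\<forall>p\<in>?P. \<not> root_at (p\<^sup>2) n) * of_bool (S \<inter> ?A = {}))"
    proof (rule sum_mono)
      fix S assume S: "S \<in> Pow ?P"
      have "(\<forall>p\<in>?P. \<not> root_at (p\<^sup>2) n) \<and> S \<inter> ?A = {}" if *: "\<forall>p\<in>?P. \<not> root_at (p ^ e S p) n"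
      proof
        show "\<forall>p\<in>?P. \<not> root_at (p\<^sup>2) n"
        proof (intro ballI notI)
          fix p assume p: "p \<in> ?P" "root_at (p\<^sup>2) n"
          have "p ^ e S p dvd p\<^sup>2" by (intro le_imp_power_dvd) (simp add: e_def)
          then have "root_at (p ^ e S p) n" using p(2) unfolding root_at_def by (rule dvd_trans)
          then show False using p(1) * by blast
        qed
        show "S \<inter> ?A = {}"
        proof (rule ccontr)
          assume "S \<inter> ?A \<noteq> {}"
          then obtain p where "p \<in> S" "p \<in> ?P" "root_at p n" by (auto simp: small_primes_of_def)
          then have "root_at (p ^ e S p) n" by (simp add: e_def)
          then show False using * \<open>p \<in> ?P\<close> by blast
        qed
      qed
      then show "(of_bool (\<forall>p\<in>?P. \<not> root_at (p ^ e S p) n) :: real) \<le>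
          of_bool (\<forall>p\<in>?P. \<not> root_at (p\<^sup>2) n) * of_bool (S \<inter> ?A = {})"
        by (cases "\<forall>p\<in>?P. \<not> root_at (p ^ e S p) n") simp_all
    qed
    also have "\<dots> = of_bool (\<forall>p\<in>?P. \<not> root_at (p\<^sup>2) n) * (?c / 2 ^ card ?A)"
      unfolding sum_distrib_left[symmetric]
      by (subst card_Pow_disjoint[OF fin]) (auto simp: small_primes_of_def)
    finally show "(\<Sum>S\<in>Pow ?P. of_bool (\<forall>p\<in>?P. \<not> root_at (p ^ e S p) n)) \<le> ?c * ?w n"
      by (simp only: times_divide_eq_right mult.commute)
  qed
  also have "\<dots> = ?c * (\<Sum>n<N. ?w n)" by (simp only: sum_distrib_left)
  finally show ?thesis by (rule mult_left_le_imp_le) simp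
qed

section \<open>The divisor function\<close>

lemma divisor_tau_pos: "m > 0 \<Longrightarrow> divisor_tau m > 0"
  unfolding divisor_tau_def by (subst card_gt_0_iff) auto

text \<open>Distinct subsets of \<open>A\<close> have distinct products, each a divisor of
  \<open>m\<close>.\<close>

lemma divisor_tau_ge_two_power:
  assumes "m > 0" "A \<subseteq> prime_factors m"
  shows "2 ^ card A \<le> divisor_tau m"
proof -
  have fin: "finite A" using assms(2) finite_subset by blast
  have A: "prime p" "p dvd m" if "p \<in> A" for p using that assms(2) by (auto simp: in_prime_factors_iff)
  have "inj_on Prod (Pow A)"
    using fin A(1) by (intro inj_on_Prod_Pow) (auto simp: pairwise_def prime_gt_Suc_0_nat intro: primes_coprime)
  moreover have "Prod ` Pow A \<subseteq> {d. d dvd m}"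
  proof (rule image_subsetI)
    fix B assume "B \<in> Pow A"
    then have B: "B \<subseteq> A" by simp
    have "\<Prod>B dvd m"
    proof (rule prod_dvd_coprime)
      show "finite B" using B fin by (rule finite_subset)
      show "p dvd m" if "p \<in> B" for p using A(2) B that by blast
      show "coprime p q" if "p \<in> B" "q \<in> B" "p \<noteq> q" for p q
        using A(1) B that by (intro primes_coprime) blast+
    qed
    then show "\<Prod>B \<in> {d. d dvd m}" by simp
  qed
  ultimately have "card (Pow A) \<le> card {d. d dvd m}"
    using assms(1) by (intro card_inj_on_le[of Prod]) auto
  then show ?thesis using fin by (simp add: divisor_tau_def card_Pow)
qed

lemma divisor_tau_prime_mult_le:
  assumes "prime p" "m > 0"
  shows "divisor_tau (p * m) \<le> 2 * divisor_tau m"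
proof -
  let ?D = "{d. d dvd m}"
  have fin: "finite ?D" using assms by simp
  have "{d. d dvd p * m} \<subseteq> ?D \<union> (*) p ` ?D"
  proof
    fix d assume d: "d \<in> {d. d dvd p * m}"
    show "d \<in> ?D \<union> (*) p ` ?D"
    proof (cases "p dvd d")
      case True
      then obtain e where "d = p * e" by blast
      then show ?thesis using d assms(1) by (auto simp: prime_gt_0_nat)
    next
      case False
      then have "coprime d p" using assms(1) prime_imp_coprime coprime_commute by blast
      then show ?thesis using d coprime_dvd_mult_right_iff by blast
    qed
  qed
  then have "card {d. d dvd p * m} \<le> card (?D \<union> (*) p ` ?D)" using fin by (intro card_mono) auto
  also have "\<dots> \<le> card ?D + card ((*) p ` ?D)" by (rule card_Un_le)
  also have "card ((*) p ` ?D) \<le> card ?D" using fin by (rule card_image_le)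
  finally show ?thesis by (simp add: divisor_tau_def)
qed

lemma divisor_tau_le_two_power: "m > 0 \<Longrightarrow> divisor_tau m \<le> 2 ^ size (prime_factorization m)"
proof (induction m rule: less_induct)
  case (less m)
  show ?case
  proof (cases "m = 1")
    case True
    then show ?thesis by (simp add: divisor_tau_def)
  next
    case False
    then obtain p where p: "prime p" "p dvd m" using prime_factor_nat by blast
    then obtain k where k: "m = p * k" by blast
    have k0: "k > 0" "k < m" using less.prems k prime_gt_1_nat[OF p(1)] by (auto intro: Nat.gr0I)
    have "prime_factorization m = add_mset p (prime_factorization k)"
      using k k0 p(1) by (simp add: prime_factorization_mult prime_factorization_prime)
    then have "2 * 2 ^ size (prime_factorization k) = (2::nat) ^ size (prime_factorization m)" by simp
    moreover have "divisor_tau m \<le> 2 * divisor_tau k"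
      unfolding k using p(1) k0(1) by (rule divisor_tau_prime_mult_le)
    ultimately show ?thesis using less.IH[OF k0(2,1)] by linarith
  qed
qed

lemma not_four_dvd_square_plus_one: "\<not> 4 dvd (m::nat)\<^sup>2 + 1"
proof (cases "even m")
  case True
  then have "4 dvd m\<^sup>2" by (auto simp: power2_eq_square elim!: evenE)
  then show ?thesis by presburger
next
  case False
  then obtain k where "m = 2 * k + 1" by (auto elim: oddE)
  then have "m\<^sup>2 + 1 = 4 * (k\<^sup>2 + k) + 2" by (simp add: power2_eq_square algebra_simps)
  then show ?thesis by presburger
qed

text \<open>Prime factors are counted with multiplicity: 2 at most once because 4 never divides the
  value, each prime of \<open>small_primes_of y n\<close> once by \<open>sqfree\<close>, and fewer
  than \<open>K\<close> above \<open>y\<close> by size. Primes 3 modulo 4 do not occur.\<close>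

lemma divisor_tau_square_plus_one_le:
  assumes "y \<ge> 2" and sqfree: "\<forall>p\<in>primes_1mod4 y. \<not> root_at (p\<^sup>2) n"
    and small: "(n + 1)\<^sup>2 + 1 < (y + 1) ^ K"
  shows "divisor_tau ((n + 1)\<^sup>2 + 1) \<le> 2 ^ (card (small_primes_of y n) + 1 + K)"
proof -
  define v where "v = (n + 1)\<^sup>2 + 1"
  have v: "v > 0" by (simp add: v_def)
  let ?A = "small_primes_of y n" and ?B = "{p \<in> prime_factors v. p > y}"
  let ?m = "\<lambda>p. multiplicity p v"
  have fin: "finite ?A" "finite ?B"
    using finite_primes_1mod4[of y] by (auto simp: small_primes_of_def)
  have mult_le: "?m p \<le> 1" if "prime p" "\<not> p\<^sup>2 dvd v" for p
  proof (rule ccontr)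
    assume "\<not> ?m p \<le> 1"
    then have "p\<^sup>2 dvd v" by (intro multiplicity_dvd') simp
    then show False using that by simp
  qed
  have cover: "prime_factors v \<subseteq> insert 2 (?A \<union> ?B)"
  proof
    fix p assume p: "p \<in> prime_factors v"
    then have pp: "prime p" "p dvd v" by (auto simp: in_prime_factors_iff)
    show "p \<in> insert 2 (?A \<union> ?B)"
    proof (cases "p = 2 \<or> p > y")
      case False
      then have "odd p" using pp(1) prime_odd_nat prime_ge_2_nat by (metis le_neq_implies_less)
      then have "p mod 4 = 1" using prime_dvd_square_plus_one_iff[OF pp(1)] pp(2) v_def by blast
      then show ?thesis using False pp by (auto simp: small_primes_of_def primes_1mod4_def root_at_def v_def)
    qed (use p in auto)
  qed
  have "size (prime_factorization v) = (\<Sum>p\<in>prime_factors v. ?m p)"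
    unfolding size_multiset_overloaded_eq
    by (intro sum.cong refl) (auto simp: in_prime_factors_iff count_prime_factorization_prime)
  also have "\<dots> \<le> (\<Sum>p\<in>insert 2 (?A \<union> ?B). ?m p)" using fin cover by (intro sum_mono2) auto
  also have "\<dots> \<le> ?m 2 + (\<Sum>p\<in>?A \<union> ?B. ?m p)"
    using fin by (cases "2 \<in> ?A \<union> ?B") (simp_all add: insert_absorb)
  also have "(\<Sum>p\<in>?A \<union> ?B. ?m p) = (\<Sum>p\<in>?A. ?m p) + (\<Sum>p\<in>?B. ?m p)"
    using fin by (intro sum.union_disjoint) (auto simp: small_primes_of_def dest: primes_1mod4D(4))
  also have "?m 2 \<le> 1"
  proof (rule mult_le)
    show "\<not> 2\<^sup>2 dvd v" using not_four_dvd_square_plus_one[of "n + 1"] unfolding v_def by simp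
  qed simp
  also have "(\<Sum>p\<in>?A. ?m p) \<le> (\<Sum>p\<in>?A. 1)"
  proof (rule sum_mono, rule mult_le)
    fix p assume "p \<in> ?A"
    then have p: "p \<in> primes_1mod4 y" by (simp add: small_primes_of_def)
    show "prime p" using p by (rule primes_1mod4D)
    show "\<not> p\<^sup>2 dvd v" using sqfree p unfolding root_at_def v_def by blast
  qed
  also have "(\<Sum>p\<in>?B. ?m p) \<le> K"
  proof -
    have "(y + 1) ^ (\<Sum>p\<in>?B. ?m p) = (\<Prod>p\<in>?B. (y + 1) ^ ?m p)" by (rule power_sum)
    also have "\<dots> \<le> (\<Prod>p\<in>?B. p ^ ?m p)"
    proof (rule prod_mono)
      fix p assume "p \<in> ?B"
      then show "0 \<le> (y + 1) ^ ?m p \<and> (y + 1) ^ ?m p \<le> p ^ ?m p" by (simp add: power_mono)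
    qed
    also have "\<dots> \<le> v"
    proof (rule dvd_imp_le)
      have "(\<Prod>p\<in>?B. p ^ ?m p) dvd (\<Prod>p\<in>prime_factors v. p ^ ?m p)"
        by (rule prod_dvd_prod_subset) auto
      then show "(\<Prod>p\<in>?B. p ^ ?m p) dvd v" using prime_factorization_nat[OF v] by simp
    qed (rule v)
    finally have "(y + 1) ^ (\<Sum>p\<in>?B. ?m p) < (y + 1) ^ K" using small unfolding v_def by linarith
    then have "(\<Sum>p\<in>?B. ?m p) < K" by (rule power_less_imp_less_exp[rotated]) (use \<open>y \<ge> 2\<close> in simp)
    then show ?thesis by simp
  qed
  finally have "size (prime_factorization v) \<le> card ?A + 1 + K" by simp
  then have "(2::nat) ^ size (prime_factorization v) \<le> 2 ^ (card ?A + 1 + K)"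
    by (intro power_increasing) auto
  then show ?thesis using divisor_tau_le_two_power[OF v] unfolding v_def by linarith
qed

section \<open>Assembly of the two bounds\<close>

lemma recip_tau_sum_eq:
  "recip_tau_sum x = (\<Sum>n<nat \<lfloor>x\<rfloor>. 1 / real (divisor_tau ((n + 1)\<^sup>2 + 1)))"
proof -
  have "real n \<le> x \<longleftrightarrow> n \<le> nat \<lfloor>x\<rfloor>" if "1 \<le> n" for n
    using that by (intro iffI; linarith)
  then have "{n. 1 \<le> n \<and> real n \<le> x} = {1..nat \<lfloor>x\<rfloor>}" by auto
  then show ?thesis unfolding recip_tau_sum_def by (simp add: sum.atLeast1_atMost_eq)
qed

lemma recip_tau_sum_upper:
  assumes "y \<ge> 2"
  shows "recip_tau_sum x \<le> 4 * real (nat \<lfloor>x\<rfloor>) * sqrt (6 / ln (real y)) + 8 * real y ^ 32"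
proof -
  have "recip_tau_sum x \<le> (\<Sum>n<nat \<lfloor>x\<rfloor>. 1 / 2 ^ card (small_primes_of y n))"
    unfolding recip_tau_sum_eq
  proof (rule sum_mono)
    fix n
    have "small_primes_of y n \<subseteq> prime_factors ((n + 1)\<^sup>2 + 1)"
      by (auto simp: small_primes_of_def root_at_def in_prime_factors_iff dest: primes_1mod4D(1))
    then have "2 ^ card (small_primes_of y n) \<le> divisor_tau ((n + 1)\<^sup>2 + 1)"
      by (intro divisor_tau_ge_two_power) simp_all
    then have "real (2 ^ card (small_primes_of y n)) \<le> real (divisor_tau ((n + 1)\<^sup>2 + 1))"
      by (rule of_nat_mono)
    then show "1 / real (divisor_tau ((n + 1)\<^sup>2 + 1)) \<le> 1 / 2 ^ card (small_primes_of y n)"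
      by (intro divide_left_mono) (simp_all add: divisor_tau_pos)
  qed
  also have "\<dots> \<le> 4 * real (nat \<lfloor>x\<rfloor>) * (\<Prod>p\<in>primes_1mod4 y. 1 - 1 / real p) + 8 * real y ^ 32"
    using assms by (rule weighted_count_upper)
  also have "(\<Prod>p\<in>primes_1mod4 y. 1 - 1 / real p) \<le> sqrt (6 / ln (real y))"
    using prod_primes_1mod4_upper[OF assms] by (rule real_le_rsqrt)
  finally show ?thesis by (simp add: mult_left_mono)
qed

text \<open>Terms whose value is divisible by some \<open>p\<^sup>2\<close> are dropped; for the
  others the prime 2 and the primes above \<open>y\<close> cost at most the factor
  \<open>2 ^ (1 + K)\<close>.\<close>

lemma recip_tau_sum_lower:
  assumes "y \<ge> 2" "(nat \<lfloor>x\<rfloor>)\<^sup>2 + 1 < (y + 1) ^ K"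
  shows "(real (nat \<lfloor>x\<rfloor>) / 8 * sqrt (1 / (4 + 32 * ln (real y))) - 4 * real y ^ 48) / 2 ^ (1 + K)
    \<le> recip_tau_sum x"
proof -
  let ?N = "nat \<lfloor>x\<rfloor>" and ?V = "\<Prod>p\<in>primes_1mod4 y. 1 - 1 / real p - 1 / (real p)\<^sup>2"
  have "?V \<ge> 0"
  proof (rule prod_nonneg)
    fix p assume "p \<in> primes_1mod4 y"
    then have "real p \<ge> 5" using primes_1mod4D(3) by force
    then have "1 / real p \<le> 1 / 2" "1 / (real p)\<^sup>2 \<le> 1 / real p"
      by (auto simp: field_simps power2_eq_square)
    then show "0 \<le> 1 - 1 / real p - 1 / (real p)\<^sup>2" by linarith
  qed
  then have "sqrt (1 / (4 + 32 * ln (real y))) \<le> ?V"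
    using prod_primes_1mod4_lower[OF assms(1)] by (rule real_le_lsqrt)
  then have "real ?N / 8 * sqrt (1 / (4 + 32 * ln (real y))) - 4 * real y ^ 48 \<le> real ?N / 8 * ?V - 4 * real y ^ 48"
    by (intro diff_right_mono mult_left_mono) auto
  also have "\<dots> \<le> (\<Sum>n<?N. of_bool (\<forall>p\<in>primes_1mod4 y. \<not> root_at (p\<^sup>2) n) / 2 ^ card (small_primes_of y n))"
    using assms(1) by (rule weighted_count_lower)
  also have "\<dots> \<le> (\<Sum>n<?N. 2 ^ (1 + K) * (1 / real (divisor_tau ((n + 1)\<^sup>2 + 1))))"
  proof (rule sum_mono)
    fix n assume n: "n \<in> {..<?N}"
    show "of_bool (\<forall>p\<in>primes_1mod4 y. \<not> root_at (p\<^sup>2) n) / 2 ^ card (small_primes_of y n) \<le>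
      2 ^ (1 + K) * (1 / real (divisor_tau ((n + 1)\<^sup>2 + 1)))"
    proof (cases "\<forall>p\<in>primes_1mod4 y. \<not> root_at (p\<^sup>2) n")
      case True
      have "(n + 1)\<^sup>2 \<le> ?N\<^sup>2" using n by (intro power_mono) auto
      then have "(n + 1)\<^sup>2 + 1 < (y + 1) ^ K" using assms(2) by linarith
      then have "divisor_tau ((n + 1)\<^sup>2 + 1) \<le> 2 ^ (card (small_primes_of y n) + 1 + K)"
        using assms(1) True by (intro divisor_tau_square_plus_one_le)
      then have "real (divisor_tau ((n + 1)\<^sup>2 + 1)) \<le> real (2 ^ (card (small_primes_of y n) + 1 + K))"
        by (rule of_nat_mono)
      also have "\<dots> = 2 ^ card (small_primes_of y n) * 2 ^ (1 + K)" by (simp add: power_add)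
      finally show ?thesis using True divisor_tau_pos[of "(n + 1)\<^sup>2 + 1"]
        by (simp add: divide_simps mult.commute)
    next
      case False
      then have "of_bool (\<forall>p\<in>primes_1mod4 y. \<not> root_at (p\<^sup>2) n) = (0 :: real)" by (simp only: of_bool_eq)
      then show ?thesis by (simp only: div_0) simp
    qed
  qed
  also have "\<dots> = 2 ^ (1 + K) * recip_tau_sum x"
    unfolding recip_tau_sum_eq by (simp only: sum_distrib_left)
  finally show ?thesis by (subst pos_divide_le_eq) (simp_all only: mult.commute zero_less_power zero_less_numeral)
qed

theorem theorem1p2:
  shows "\<exists>c\<^sub>1 c\<^sub>2 x\<^sub>0 :: real. c\<^sub>1 > 0 \<and> c\<^sub>2 > 0 \<and> x\<^sub>0 \<ge> 2 \<and>
    (\<forall>x \<ge> x\<^sub>0. c\<^sub>1 * (x / (ln x) powr (1/2)) \<le> recip_tau_sum x \<and>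
      recip_tau_sum x \<le> c\<^sub>2 * (x / (ln x) powr (1/2)))"
proof -
  \<comment> \<open>The first condition absorbs the floor in \<open>y\<close>,
    \<open>ln x \<ge> 100\<close> yields \<open>4 + 32 * ln y \<le> ln x\<close>, and the last two
    make the sieve errors \<open>8 * y ^ 32\<close> and \<open>4 * y ^ 48\<close> small against the
    main terms.\<close>
  have "\<forall>\<^sub>F x :: real in at_top. x powr (1/200) \<ge> 2" by real_asymp
  moreover have "\<forall>\<^sub>F x :: real in at_top. ln x \<ge> 100" by real_asymp
  moreover have "\<forall>\<^sub>F x :: real in at_top. 8 * x powr (32/100) \<le> x / sqrt (ln x)" by real_asymp
  moreover have "\<forall>\<^sub>F x :: real in at_top. 4 * x powr (48/100) \<le> x / 64 / sqrt (ln x)" by real_asymp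
  ultimately have "\<forall>\<^sub>F x in at_top. 1 / (64 * 2 ^ 301) * (x / (ln x) powr (1/2)) \<le> recip_tau_sum x \<and>
      recip_tau_sum x \<le> 141 * (x / (ln x) powr (1/2))"
    using eventually_ge_at_top[of 2]
  proof eventually_elim
    case (elim x)
    \<comment> \<open>The exponent keeps \<open>y ^ 48\<close> at most
      \<open>x powr (48/100)\<close>, while \<open>(y + 1) ^ 300\<close> still exceeds
      \<open>x ^ 3\<close>, which allows the fixed value \<open>K = 300\<close>.\<close>
    define y where "y = nat \<lfloor>x powr (1/100)\<rfloor>"
    let ?N = "nat \<lfloor>x\<rfloor>"
    have N: "real ?N \<le> x" "x / 2 \<le> real ?N" using elim(5) by linarith+
    have lnx: "ln x > 0" and sl: "sqrt (ln x) > 0" using elim(2) by auto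
    have halfpow: "x powr (1/100) = x powr (1/200) * x powr (1/200)" by (simp flip: powr_add)
    have p100: "x powr (1/100) \<ge> 2 * x powr (1/200)"
      unfolding halfpow using elim(1) by (intro mult_right_mono) auto
    have y_le: "real y \<le> x powr (1/100)" unfolding y_def by (intro of_nat_floor) simp
    have y_gt: "x powr (1/100) < real y + 1" unfolding y_def by linarith
    have y_ge: "x powr (1/200) \<le> real y" using y_gt p100 elim(1) by linarith
    have y2: "y \<ge> 2" using y_ge elim(1) by linarith
    have ln_ge: "ln x / 200 \<le> ln (real y)"
    proof -
      have "ln (x powr (1/200)) \<le> ln (real y)" using y_ge elim(1) by (subst ln_le_cancel_iff) auto
      then show ?thesis using elim(5) by (simp add: ln_powr)
    qed
    have ln_le: "ln (real y) \<le> ln x / 100"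
    proof -
      have "ln (real y) \<le> ln (x powr (1/100))" using y_le y2 elim(5) by (subst ln_le_cancel_iff) auto
      then show ?thesis using elim(5) by (simp add: ln_powr)
    qed
    have pow: "real y ^ k \<le> x powr (k / 100)" for k
    proof -
      have "real y ^ k \<le> (x powr (1/100)) ^ k" using y_le by (intro power_mono) auto
      also have "\<dots> = x powr (k / 100)" using elim(5) by (simp add: powr_power)
      finally show ?thesis .
    qed
    have "recip_tau_sum x \<le> 4 * real ?N * sqrt (6 / ln (real y)) + 8 * real y ^ 32"
      using y2 by (rule recip_tau_sum_upper)
    also have "\<dots> \<le> 4 * x * (35 / sqrt (ln x)) + x / sqrt (ln x)"
    proof (intro add_mono mult_mono)
      \<comment> \<open>\<open>6 * 200 \<le> 35\<^sup>2\<close>, and \<open>4 * 35 + 1 = 141\<close>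
        is the upper constant.\<close>
      have "6 / ln (real y) \<le> 6 / (ln x / 200)" using ln_ge lnx by (intro divide_left_mono) auto
      also have "\<dots> \<le> 35\<^sup>2 / ln x" using lnx by (simp add: divide_right_mono)
      finally have "sqrt (6 / ln (real y)) \<le> sqrt (35\<^sup>2 / ln x)" by (rule real_sqrt_le_mono)
      then show "sqrt (6 / ln (real y)) \<le> 35 / sqrt (ln x)" by (simp add: real_sqrt_divide)
      show "8 * real y ^ 32 \<le> x / sqrt (ln x)" using pow[of 32] elim(3) by simp
    qed (use N elim(5) y2 in auto)
    also have "\<dots> = 141 * (x / (ln x) powr (1/2))" using lnx by (simp add: powr_half_sqrt field_simps)
    finally have upper: "recip_tau_sum x \<le> 141 * (x / (ln x) powr (1/2))" .
    have "?N\<^sup>2 + 1 < (y + 1) ^ 300"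
    proof -
      have "real (?N\<^sup>2 + 1) \<le> x\<^sup>2 + 1" using N by (simp add: power_mono)
      also have "\<dots> \<le> 2 * x\<^sup>2" using elim(5) by (simp add: one_le_power)
      also have "\<dots> \<le> x * x\<^sup>2" using elim(5) by (intro mult_right_mono) auto
      also have "\<dots> = (x powr (1/100)) ^ 300"
        using elim(5) by (simp add: powr_power power2_eq_square power3_eq_cube)
      also have "\<dots> < (real y + 1) ^ 300" using y_gt by (intro power_strict_mono) auto
      finally have "real (?N\<^sup>2 + 1) < real ((y + 1) ^ 300)" by (simp add: add.commute)
      then show ?thesis by (simp only: of_nat_less_iff)
    qed
    then have low: "(real ?N / 8 * sqrt (1 / (4 + 32 * ln (real y))) - 4 * real y ^ 48) / 2 ^ (1 + 300) \<le> recip_tau_sum x"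
      using y2 by (intro recip_tau_sum_lower)
    \<comment> \<open>The 1/16 comes from \<open>N / 8\<close> with \<open>N \<ge> x / 2\<close>; a
      quarter of it pays for the sieve error, and 3/64 is more than the 1/64 kept.\<close>
    have "x / 64 / sqrt (ln x) \<le> x / 16 * (1 / sqrt (ln x)) - x / 64 / sqrt (ln x)"
      using elim(5) sl by (simp add: field_simps)
    also have "\<dots> \<le> real ?N / 8 * sqrt (1 / (4 + 32 * ln (real y))) - 4 * real y ^ 48"
    proof (intro diff_mono mult_mono)
      have "4 + 32 * ln (real y) \<le> ln x" using ln_le elim(2) by linarith
      moreover have "0 < 4 + 32 * ln (real y)" using ln_ge lnx by linarith
      ultimately have "1 / ln x \<le> 1 / (4 + 32 * ln (real y))" using lnx by (intro divide_left_mono) auto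
      then have "sqrt (1 / ln x) \<le> sqrt (1 / (4 + 32 * ln (real y)))" by (rule real_sqrt_le_mono)
      then show "1 / sqrt (ln x) \<le> sqrt (1 / (4 + 32 * ln (real y)))" by (simp add: real_sqrt_divide)
      show "4 * real y ^ 48 \<le> x / 64 / sqrt (ln x)" using pow[of 48] elim(4) by simp
    qed (use N elim(5) sl in auto)
    finally have "x / 64 / sqrt (ln x) / 2 ^ 301 \<le> recip_tau_sum x"
      using low by (simp add: divide_right_mono order_trans)
    moreover have "1 / (64 * 2 ^ 301) * (x / (ln x) powr (1/2)) = x / 64 / sqrt (ln x) / 2 ^ 301"
      using lnx by (simp add: powr_half_sqrt)
    ultimately have "1 / (64 * 2 ^ 301) * (x / (ln x) powr (1/2)) \<le> recip_tau_sum x" by (simp only:)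
    then show ?case using upper by (rule conjI)
  qed
  then obtain x1 where x1: "\<And>x. x \<ge> x1 \<Longrightarrow> 1 / (64 * 2 ^ 301) * (x / (ln x) powr (1/2)) \<le> recip_tau_sum x \<and>
      recip_tau_sum x \<le> 141 * (x / (ln x) powr (1/2))"
    unfolding eventually_at_top_linorder by blast
  show ?thesis
  proof (intro exI conjI allI impI)
    show "0 < 1 / (64 * 2 ^ 301 :: real)" "0 < (141 :: real)" "2 \<le> max 2 x1" by simp_all
  qed (use x1 in auto)
qed

end
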